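(* Let $p=p_n$ be positive integers with $p\le n$, $p\to\infty$ and $p/n\to 0$ as $n\to\infty$. Let $(s_1,\ldots,s_p)\in\mathbb{R}_+^p$ be random with joint law having density $$\frac{1}{D_{p,n}}\prod_{1\le i<j\le p}|s_i^2-s_j^2|^2\cdot\prod_{i=1}^p s_i^{2(n-p)+1}\cdot\prod_{i=1}^p e^{-ns_i^2}$$ with respect to Lebesgue measure on $\mathbb{R}_+^p$, where $D_{p,n}$ is the normalizing constant. Let $$\hat\mu_p^T=\frac1p\sum_{i=1}^p\left(\frac12\delta_{s_i}+\frac12\delta_{-s_i}\right).$$ Then $\hat\mu_p^T$ satisfies a large deviation principle on $\mathcal{M}^{\mathrm{sym}}(\mathbb{R})$ with speed $pn$ and good rate function $$I^{\mathrm{sym}}(\mu)=\int (x^2-\log x^2)\,d\mu(x)-1.$$ Moreover, $I^{\mathrm{sym}}$ admits a unique minimizer on $\mathcal{M}^{\mathrm{sym}}(\mathbb{R})$, given by the Rademacher distribution $\mathrm{b}=\frac12\delta_{-1}+\frac12\delta_1$.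
   Context: $\mathbb{R}_+=[0,\infty)$. $\mathcal{M}(\mathbb{R})$ is the space of Borel probability measures on $\mathbb{R}$ with the weak topology, metrized by $d_{BL}(\mu,\nu)=\sup_f|\int f\,d\mu-\int f\,d\nu|$ over $f:\mathbb{R}\to\mathbb{R}$ with Lipschitz constant at most $1$ and $|f|\le 1$. $\mathcal{M}^{\mathrm{sym}}(\mathbb{R})$ is the subspace of symmetric probability measures ($\mu(B)=\mu(-B)$ for every Borel $B$). By convention $-\log 0=+\infty$. Large deviation principle: a sequence of random elements of a Polish space $X$ with laws $\mu_N$ satisfies a large deviation principle with speed $a_N\to\infty$ and rate function $I$ if (a) $I:X\to[0,\infty]$ is lower semicontinuous; (b) for every open $O\subset X$, $\liminf_{N}\frac1{a_N}\log\mu_N(O)\ge-\inf_O I$; (c) for every closed $F\subset X$, $\limsup_{N}\frac1{a_N}\log\mu_N(F)\le-\inf_F I$. The rate function is good if $\{I\le C\}$ is compact for every $C\ge 0$. *)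

theory Defs
  imports "HOL-Probability.Probability"
begin

section \<open>Borel probability measures on the line, bounded Lipschitz metric\<close>

definition prob_measures :: "real measure set" where
  "prob_measures = {\<mu>. real_distribution \<mu>}"

definition sym_prob_measures :: "real measure set" where
  "sym_prob_measures =
     {\<mu> \<in> prob_measures. \<forall>B \<in> sets borel. measure \<mu> B = measure \<mu> (uminus ` B)}"

definition BL1 :: "(real \<Rightarrow> real) set" where
  "BL1 = {f. 1-lipschitz_on UNIV f \<and> (\<forall>x. \<bar>f x\<bar> \<le> 1)}"

text \<open>The value 0 outside \<^term>\<open>prob_measures\<close> is a dummy; it is there because the locale
  \<^locale>\<open>Metric_space\<close> asks for a distance that is nonnegative on the whole type.\<close>

definition d_BL :: "real measure \<Rightarrow> real measure \<Rightarrow> real" where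
  "d_BL \<mu> \<nu> =
     (if \<mu> \<in> prob_measures \<and> \<nu> \<in> prob_measures
      then (SUP f \<in> BL1. \<bar>(\<integral>x. f x \<partial>\<mu>) - (\<integral>x. f x \<partial>\<nu>)\<bar>) else 0)"

definition weak_topology :: "real measure topology" where
  "weak_topology = Metric_space.mtopology prob_measures d_BL"

definition sym_weak_topology :: "real measure topology" where
  "sym_weak_topology = subtopology weak_topology sym_prob_measures"

lemma BL1_integrable:
  assumes "f \<in> BL1" "\<mu> \<in> prob_measures"
  shows "integrable \<mu> f" "\<bar>\<integral>x. f x \<partial>\<mu>\<bar> \<le> 1"
proof -
  interpret real_distribution \<mu> using assms by (simp add: prob_measures_def)
  have "continuous_on UNIV f"
    using assms(1) by (auto simp: BL1_def intro: lipschitz_on_continuous_on)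
  then have "f \<in> borel_measurable borel"
    by (rule borel_measurable_continuous_onI)
  then have m: "f \<in> borel_measurable \<mu>" by simp
  have b: "\<bar>f x\<bar> \<le> 1" for x using assms(1) by (auto simp: BL1_def)
  show i: "integrable \<mu> f"
    by (rule integrable_const_bound[of _ 1]) (use m b in auto)
  have "\<bar>\<integral>x. f x \<partial>\<mu>\<bar> \<le> (\<integral>x. \<bar>f x\<bar> \<partial>\<mu>)"
    by (rule integral_abs_bound)
  also have "\<dots> \<le> (\<integral>x. 1 \<partial>\<mu>)"
    by (rule integral_mono) (use i b in auto)
  finally show "\<bar>\<integral>x. f x \<partial>\<mu>\<bar> \<le> 1" using prob_space by simp
qed

lemma BL1_zero: "(\<lambda>_. 0) \<in> BL1"
  by (auto simp: BL1_def lipschitz_on_def)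

lemma d_BL_bdd:
  assumes "\<mu> \<in> prob_measures" "\<nu> \<in> prob_measures"
  shows "bdd_above ((\<lambda>f. \<bar>(\<integral>x. f x \<partial>\<mu>) - (\<integral>x. f x \<partial>\<nu>)\<bar>) ` BL1)"
  by (rule bdd_aboveI[of _ 2])
     (use BL1_integrable(2)[OF _ assms(1)] BL1_integrable(2)[OF _ assms(2)] in fastforce)

lemma d_BL_upper:
  assumes "\<mu> \<in> prob_measures" "\<nu> \<in> prob_measures" "f \<in> BL1"
  shows "\<bar>(\<integral>x. f x \<partial>\<mu>) - (\<integral>x. f x \<partial>\<nu>)\<bar> \<le> d_BL \<mu> \<nu>"
  using cSUP_upper[OF assms(3) d_BL_bdd[OF assms(1,2)]] assms by (simp add: d_BL_def)

lemma d_BL_zero_imp_eq: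
  assumes \<mu>: "\<mu> \<in> prob_measures" and \<nu>: "\<nu> \<in> prob_measures" and z: "d_BL \<mu> \<nu> = 0"
  shows "\<mu> = \<nu>"
proof -
  have key: "cdf \<mu> x \<le> cdf \<nu> x"
    if \<mu>: "\<mu> \<in> prob_measures" and \<nu>: "\<nu> \<in> prob_measures"
      and eq: "\<And>f. f \<in> BL1 \<Longrightarrow> (\<integral>x. f x \<partial>\<mu>) = (\<integral>x. f x \<partial>\<nu>)" for \<mu> \<nu> x
  proof -
    interpret m: real_distribution \<mu> using \<mu> by (simp add: prob_measures_def)
    interpret n: real_distribution \<nu> using \<nu> by (simp add: prob_measures_def)
    have le: "cdf \<mu> x \<le> cdf \<nu> y" if y: "x < y" for y
    proof -
      define c where "c = min 1 (y - x)"
      have c: "0 < c" "c \<le> 1" "c \<le> y - x" using y by (auto simp: c_def)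
      have cs: "cts_step x y t = max 0 (min 1 ((y - t) / (y - x)))" for t
        using y by (auto simp: cts_step_def field_simps)
      have clip: "\<bar>max 0 (min 1 a) - max 0 (min 1 b)\<bar> \<le> \<bar>a - b\<bar>" for a b :: real by linarith
      have lip: "\<bar>c * cts_step x y s - c * cts_step x y t\<bar> \<le> \<bar>s - t\<bar>" for s t
      proof -
        have "\<bar>c * cts_step x y s - c * cts_step x y t\<bar>
            = c * \<bar>cts_step x y s - cts_step x y t\<bar>"
          using c by (simp add: abs_mult right_diff_distrib[symmetric])
        also have "\<dots> \<le> c * \<bar>(y - s) / (y - x) - (y - t) / (y - x)\<bar>"
          unfolding cs by (rule mult_left_mono[OF clip]) (use c in auto)
        also have "(y - s) / (y - x) - (y - t) / (y - x) = (t - s) / (y - x)"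
          by (simp add: diff_divide_distrib[symmetric])
        also have "c * \<bar>(t - s) / (y - x)\<bar> = (c / (y - x)) * \<bar>s - t\<bar>"
          using y by (simp add: abs_divide abs_minus_commute)
        also have "\<dots> \<le> 1 * \<bar>s - t\<bar>"
          by (rule mult_right_mono) (use c y in auto)
        finally show ?thesis by simp
      qed
      have "0 \<le> cts_step x y t \<and> cts_step x y t \<le> 1" for t
        unfolding cs by auto
      then have "\<bar>c * cts_step x y t\<bar> \<le> 1" for t
        using c by (auto simp: abs_mult intro!: mult_le_one)
      then have "(\<lambda>t. c * cts_step x y t) \<in> BL1"
        using lip by (auto simp: BL1_def lipschitz_on_def dist_real_def)
      from eq[OF this] have "integral\<^sup>L \<mu> (cts_step x y) = integral\<^sup>L \<nu> (cts_step x y)"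
        using c by simp
      then show ?thesis
        using m.cdf_cts_step(1)[OF y] n.cdf_cts_step(2)[OF y] by simp
    qed
    have "(cdf \<nu> \<longlongrightarrow> cdf \<nu> x) (at_right x)"
      using n.cdf_is_right_cont by (simp add: continuous_within)
    then show ?thesis
      by (rule tendsto_lowerbound)
         (auto simp: eventually_at_filter intro!: always_eventually le)
  qed
  have eq: "(\<integral>x. f x \<partial>\<mu>) = (\<integral>x. f x \<partial>\<nu>)" if "f \<in> BL1" for f
    using d_BL_upper[OF \<mu> \<nu> that] z by simp
  have "cdf \<mu> = cdf \<nu>"
    by (rule ext, rule antisym) (auto intro: key \<mu> \<nu> eq eq[symmetric])
  then show ?thesis
    using \<mu> \<nu> by (intro cdf_unique) (auto simp: prob_measures_def)
qed

lemma Metric_space_d_BL: "Metric_space prob_measures d_BL"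
proof
  show "0 \<le> d_BL \<mu> \<nu>" for \<mu> \<nu>
  proof (cases "\<mu> \<in> prob_measures \<and> \<nu> \<in> prob_measures")
    case True
    then show ?thesis using d_BL_upper[OF _ _ BL1_zero, of \<mu> \<nu>] by simp
  next
    case False
    then show ?thesis by (auto simp: d_BL_def)
  qed
  show "d_BL \<mu> \<nu> = d_BL \<nu> \<mu>" for \<mu> \<nu>
    unfolding d_BL_def by (simp add: abs_minus_commute)
  show "(d_BL \<mu> \<nu> = 0) = (\<mu> = \<nu>)" if "\<mu> \<in> prob_measures" "\<nu> \<in> prob_measures" for \<mu> \<nu>
  proof
    assume "d_BL \<mu> \<nu> = 0" then show "\<mu> = \<nu>" using d_BL_zero_imp_eq that by blast
  next
    assume "\<mu> = \<nu>" then show "d_BL \<mu> \<nu> = 0"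
      using cSUP_const[of BL1 "0::real"] BL1_zero by (cases "BL1 = {}") (auto simp: d_BL_def)
  qed
  show "d_BL \<mu> \<rho> \<le> d_BL \<mu> \<nu> + d_BL \<nu> \<rho>"
    if "\<mu> \<in> prob_measures" "\<nu> \<in> prob_measures" "\<rho> \<in> prob_measures" for \<mu> \<nu> \<rho>
  proof -
    have "(SUP f \<in> BL1. \<bar>(\<integral>x. f x \<partial>\<mu>) - (\<integral>x. f x \<partial>\<rho>)\<bar>) \<le> d_BL \<mu> \<nu> + d_BL \<nu> \<rho>"
    proof (rule cSUP_least)
      show "BL1 \<noteq> {}" using BL1_zero by blast
      fix f assume "f \<in> BL1"
      then show "\<bar>(\<integral>x. f x \<partial>\<mu>) - (\<integral>x. f x \<partial>\<rho>)\<bar> \<le> d_BL \<mu> \<nu> + d_BL \<nu> \<rho>"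
        using d_BL_upper[of \<mu> \<nu> f] d_BL_upper[of \<nu> \<rho> f] that by linarith
    qed
    then show ?thesis using that by (simp add: d_BL_def)
  qed
qed

lemma topspace_sym_weak_topology: "topspace sym_weak_topology = sym_prob_measures"
  by (auto simp: sym_weak_topology_def weak_topology_def sym_prob_measures_def
      Metric_space.topspace_mtopology[OF Metric_space_d_BL])


section \<open>Large deviation principles\<close>

text \<open>The logarithm on \<open>[0,\<infinity>)\<close> with the convention \<open>log 0 = -\<infinity>\<close>; it is only applied to
  nonnegative arguments.\<close>

definition ext_ln :: "real \<Rightarrow> ereal" where
  "ext_ln x = (if x = 0 then - \<infinity> else ereal (ln x))"

definition borel_of :: "'a topology \<Rightarrow> 'a measure" where
  "borel_of X = sigma (topspace X) {U. openin X U}"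

definition lower_semicontinuous :: "'a topology \<Rightarrow> ('a \<Rightarrow> ereal) \<Rightarrow> bool" where
  "lower_semicontinuous X I \<longleftrightarrow>
     (\<forall>x \<in> topspace X. \<forall>c < I x. \<exists>U. openin X U \<and> x \<in> U \<and> (\<forall>y \<in> U. c < I y))"

definition rate_function :: "'a topology \<Rightarrow> ('a \<Rightarrow> ereal) \<Rightarrow> bool" where
  "rate_function X I \<longleftrightarrow> (\<forall>x \<in> topspace X. 0 \<le> I x) \<and> lower_semicontinuous X I"

definition good_rate_function :: "'a topology \<Rightarrow> ('a \<Rightarrow> ereal) \<Rightarrow> bool" where
  "good_rate_function X I \<longleftrightarrow>
     rate_function X I \<and> (\<forall>C::real. 0 \<le> C \<longrightarrow> compactin X {x \<in> topspace X. I x \<le> ereal C})"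

text \<open>The sequence of random elements \<open>Y N\<close>, each on its own probability space \<open>P N\<close>, is indexed by
  \<open>N \<ge> 1\<close>; nothing is asked of the junk index 0. Infima over the empty set are \<open>\<infinity>\<close>.\<close>

definition satisfies_LDP ::
    "'a topology \<Rightarrow> (nat \<Rightarrow> 'w measure) \<Rightarrow> (nat \<Rightarrow> 'w \<Rightarrow> 'a) \<Rightarrow> (nat \<Rightarrow> real) \<Rightarrow> ('a \<Rightarrow> ereal) \<Rightarrow> bool"
  where
  "satisfies_LDP X P Y a I \<longleftrightarrow>
     (\<forall>N\<ge>1. prob_space (P N) \<and> Y N \<in> P N \<rightarrow>\<^sub>M borel_of X) \<and>
     filterlim a at_top sequentially \<and>
     rate_function X I \<and>
     (\<forall>U. openin X U \<longrightarrow>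
        liminf (\<lambda>N. ereal (1 / a N) * ext_ln (measure (distr (P N) (borel_of X) (Y N)) U))
          \<ge> - (INF x\<in>U. I x)) \<and>
     (\<forall>F. closedin X F \<longrightarrow>
        limsup (\<lambda>N. ereal (1 / a N) * ext_ln (measure (distr (P N) (borel_of X) (Y N)) F))
          \<le> - (INF x\<in>F. I x))"


section \<open>The ensemble, its symmetrized empirical measure, the rate function\<close>

text \<open>Vectors \<open>(s\<^sub>1, \<dots>, s\<^sub>p)\<close> are elements of the product space over the index set \<open>{1..p}\<close>;
  the density on \<open>[0,\<infinity>)\<^sup>p\<close> is extended by 0.\<close>

definition lebesgue_vec :: "nat \<Rightarrow> (nat \<Rightarrow> real) measure" where
  "lebesgue_vec p = (\<Pi>\<^sub>M i\<in>{1..p}. lborel)"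

definition sv_weight :: "nat \<Rightarrow> nat \<Rightarrow> (nat \<Rightarrow> real) \<Rightarrow> real" where
  "sv_weight p n s =
     (if \<forall>i\<in>{1..p}. 0 \<le> s i then
        (\<Prod>(i, j) \<in> {(i, j). 1 \<le> i \<and> i < j \<and> j \<le> p}. \<bar>(s i)\<^sup>2 - (s j)\<^sup>2\<bar>\<^sup>2) *
        (\<Prod>i = 1..p. s i ^ (2 * (n - p) + 1)) *
        (\<Prod>i = 1..p. exp (- real n * (s i)\<^sup>2))
      else 0)"

definition sv_norm_const :: "nat \<Rightarrow> nat \<Rightarrow> ennreal" where
  "sv_norm_const p n = (\<integral>\<^sup>+ s. ennreal (sv_weight p n s) \<partial>lebesgue_vec p)"

definition sv_density :: "nat \<Rightarrow> nat \<Rightarrow> (nat \<Rightarrow> real) \<Rightarrow> ennreal" where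
  "sv_density p n s = ennreal (sv_weight p n s) / sv_norm_const p n"

definition sym_dirac :: "real \<Rightarrow> real measure" where
  "sym_dirac x = measure_of UNIV (sets borel)
     (\<lambda>B. 1/2 * emeasure (return borel x) B + 1/2 * emeasure (return borel (- x)) B)"

definition sym_empirical :: "nat \<Rightarrow> (nat \<Rightarrow> real) \<Rightarrow> real measure" where
  "sym_empirical p s = measure_of UNIV (sets borel)
     (\<lambda>B. 1 / of_nat p * (\<Sum>i = 1..p.
        1/2 * emeasure (return borel (s i)) B + 1/2 * emeasure (return borel (- s i)) B))"

text \<open>The distribution \<open>\<onehalf> \<delta>\<^bsub>-1\<^esub> + \<onehalf> \<delta>\<^bsub>1\<^esub>\<close>.\<close>

definition rademacher :: "real measure" where
  "rademacher = sym_dirac 1"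

text \<open>The integrand \<open>x\<^sup>2 - log x\<^sup>2\<close> is at least 1 everywhere and \<open>\<infinity>\<close> at 0, so its integral
  always exists in \<open>[0,\<infinity>]\<close> and is the nonnegative Lebesgue integral.\<close>

definition I_sym :: "real measure \<Rightarrow> ereal" where
  "I_sym \<mu> = enn2ereal (\<integral>\<^sup>+ x. e2ennreal (ereal (x\<^sup>2) - ext_ln (x\<^sup>2)) \<partial>\<mu>) - 1"

lemma I_sym_integrand_ge_1: "ereal (x\<^sup>2) - ext_ln (x\<^sup>2) \<ge> 1"
proof (cases "x = 0")
  case False
  then have "ln (x\<^sup>2) \<le> x\<^sup>2 - 1" by (intro ln_le_minus_one) simp
  with False show ?thesis by (simp add: ext_ln_def one_ereal_def)
qed (simp add: ext_ln_def)

lemma emeasure_sym_empirical: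
  assumes "B \<in> sets borel"
  shows "emeasure (sym_empirical p s) B = 1 / of_nat p * (\<Sum>i = 1..p.
    1/2 * emeasure (return borel (s i)) B + 1/2 * emeasure (return borel (- s i)) B)"
    (is "_ = ?m B")
proof (rule emeasure_measure_of[OF sym_empirical_def])
  show "positive (sets (sym_empirical p s)) ?m" by (simp add: positive_def)
  have S: "sets (sym_empirical p s) = sets borel"
    unfolding sym_empirical_def using sets.sigma_sets_eq[of "borel :: real measure"] by simp
  show "countably_additive (sets (sym_empirical p s)) ?m"
  proof (rule countably_additiveI)
    fix A :: "nat \<Rightarrow> real set"
    assume A: "range A \<subseteq> sets (sym_empirical p s)" "disjoint_family A"
    have *: "(\<Sum>k. emeasure (return borel x) (A k)) = emeasure (return borel x) (\<Union>k. A k)" for x :: real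
      by (rule suminf_emeasure) (use A S in auto)
    show "(\<Sum>k. ?m (A k)) = ?m (\<Union>k. A k)"
      by (simp only: ennreal_suminf_cmult suminf_sum[OF summableI] suminf_add[OF summableI summableI, symmetric] *)
  qed
  show "B \<in> sets (sym_empirical p s)" using assms S by simp
qed auto

lemma sym_empirical_prob:
  assumes "1 \<le> p"
  shows "sym_empirical p s \<in> sym_prob_measures"
proof -
  have S: "sets (sym_empirical p s) = sets borel"
    unfolding sym_empirical_def using sets.sigma_sets_eq[of "borel :: real measure"] by simp
  have sp: "space (sym_empirical p s) = UNIV"
    using sets_eq_imp_space_eq[OF S] by simp
  have half: "(1/2 + 1/2 :: ennreal) = 1"
    using ennreal_plus[of "1/2" "1/2"] by (simp add: divide_ennreal_def)
  have "emeasure (sym_empirical p s) UNIV = 1 / of_nat p * of_nat p"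
    by (simp add: emeasure_sym_empirical half)
  also have "\<dots> = 1"
    using assms by (simp add: ennreal_divide_times ennreal_divide_self of_nat_less_top)
  finally have "emeasure (sym_empirical p s) UNIV = 1" .
  then have "prob_space (sym_empirical p s)"
    by (intro prob_spaceI) (simp add: sp)
  then have 1: "sym_empirical p s \<in> prob_measures"
    using S by (simp add: prob_measures_def real_distribution_def real_distribution_axioms_def)
  have "measure (sym_empirical p s) B = measure (sym_empirical p s) (uminus ` B)"
    if B: "B \<in> sets borel" for B
  proof -
    have im: "uminus ` B = uminus -` B" by force
    have "uminus -` B \<in> sets borel"
      using measurable_sets[of uminus borel borel B] B by simp
    then show ?thesis
      using B by (simp add: measure_def emeasure_sym_empirical im indicator_def add.commute)
  qed
  with 1 show ?thesis by (simp add: sym_prob_measures_def)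
qed

lemma sym_dirac_eq: "sym_dirac x = sym_empirical 1 (\<lambda>_. x)"
  by (simp add: sym_dirac_def sym_empirical_def)

end

theory Submission
  imports Defs "HOL-Real_Asymp.Real_Asymp"
begin

text \<open>Write \<open>V x\<close> for \<open>x\<^sup>2 - ln (x\<^sup>2)\<close> (\<open>log_potential\<close> below). Up to the Vandermonde product and the powers
  \<open>s\<^sub>i / s\<^sub>i ^ (2 * p)\<close>, the unnormalized density of \<open>(s\<^sub>1, \<dots>, s\<^sub>p)\<close> is \<open>\<Prod>\<^sub>i exp (- n V(s\<^sub>i))\<close>, that is
  \<open>exp (- p n \<integral>V d\<mu>)\<close> for \<open>\<mu>\<close> the symmetrized empirical measure. For the configurations that matter these
  corrections are of order \<open>exp (O(p\<^sup>2))\<close>, which is negligible at speed \<open>p n\<close> because \<open>p / n\<close> tends to 0.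
  So the points do not interact at this scale, and there is no entropy
  either: \<open>p\<close> points occupy volumes of order \<open>exp (- O(p ln p))\<close>. What is left is the integral of \<open>V\<close>, and
  the constant \<open>1 = min V\<close> comes from the normalization.

  Upper bound. Since \<open>\<bar>a - b\<bar> \<le> (1 + a) (1 + b)\<close> for \<open>a, b \<ge> 0\<close>, the squared Vandermonde product is at most
  \<open>\<Prod>\<^sub>i (1 + s\<^sub>i\<^sup>2) ^ (2 * p)\<close>, and these factors are absorbed by the part \<open>exp (- p s\<^sub>i\<^sup>2)\<close> of the Gaussian at the price of
  \<open>exp (p\<^sup>2)\<close>. Setting two copies of \<open>exp (- V(s\<^sub>i))\<close> aside to keep the integral finite, the weight of any
  measurable set on which \<open>\<Sum>\<^sub>i V(s\<^sub>i) \<ge> p v\<close> is at most \<open>exp (p\<^sup>2 - (n - p - 2) p v)\<close> (\<open>sv_mass_le\<close>). Applied to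
  the preimage of a closed set this is the upper bound.

  Lower bound. Let \<open>\<mu>\<close> be symmetric with \<open>\<integral>V d\<mu> \<le> G\<close>. Cut \<open>(0, 1)\<close> into \<open>p\<close> bins of equal length and take in
  each bin a value \<open>y\<^sub>i\<close> of the quantile function of \<open>\<bar>x\<bar>\<close> under \<open>\<mu>\<close> at which \<open>V\<close> does not exceed its mean over
  the bin. Then \<open>\<Sum>\<^sub>i V(y\<^sub>i)\<close> is at most about \<open>p G\<close>, and the empirical measures of the \<open>y\<^sub>i\<close> converge to \<open>\<mu>\<close>
  (\<open>quantile_points\<close>). The \<open>y\<^sub>i\<close> increase with \<open>i\<close>, perhaps with ties; moving \<open>y\<^sub>i\<close> by \<open>\<delta> i / p\<close> and
  allowing an error \<open>\<delta> / (2 p)\<close> gives a box on which \<open>s\<^sub>j - s\<^sub>i \<ge> \<delta> (j - i) / (2 p)\<close>. The product of these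
  gaps is at least \<open>exp (- O(p\<^sup>2))\<close> and not merely \<open>exp (- O(p\<^sup>2 ln p))\<close>, which would be too small as
  \<open>p ln p / n\<close> need not tend to 0; this rests on \<open>p\<^sup>k / k! \<le> exp p\<close> (\<open>prod_pairs_ge\<close>). Hence the weight of the box
  is at least \<open>exp (- p n (G + O(\<delta>)))\<close> (\<open>sv_mass_spread_box_ge\<close>). The case \<open>y\<^sub>i = 1\<close>, where \<open>V\<close> attains its
  minimum 1, bounds the normalizing constant from below.

  Rate function. On \<open>{I_sym \<le> C}\<close> the second moments are bounded, so a sequence there has a weakly
  convergent subsequence. By Skorohod's representation weak convergence implies convergence in \<open>d_BL\<close>,
  and, \<open>V\<close> being continuous into \<open>[0, \<infinity>]\<close>, Fatou's lemma keeps the limit in the sublevel set. So the sublevel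
  sets are compact, hence closed, which is lower semicontinuity. Finally \<open>V \<ge> 1\<close> with equality exactly at
  \<open>\<plusminus> 1\<close>, so a symmetric measure with \<open>I_sym \<mu> = 0\<close> lives on these two points.\<close>

section \<open>Weak convergence and the bounded Lipschitz metric\<close>

lemma prob_measures_eqI:
  assumes \<mu>: "\<mu> \<in> prob_measures" and \<nu>: "\<nu> \<in> prob_measures"
    and eq: "\<And>f. f \<in> BL1 \<Longrightarrow> (\<integral>x. f x \<partial>\<mu>) = (\<integral>x. f x \<partial>\<nu>)"
  shows "\<mu> = \<nu>"
proof (rule d_BL_zero_imp_eq[OF \<mu> \<nu>])
  have "(SUP f\<in>BL1. \<bar>(\<integral>x. f x \<partial>\<mu>) - (\<integral>x. f x \<partial>\<nu>)\<bar>) = (SUP f\<in>BL1. 0)"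
    using eq by (intro SUP_cong) auto
  also have "\<dots> = 0" using BL1_zero by (intro cSUP_const) auto
  finally show "d_BL \<mu> \<nu> = 0" by (simp add: d_BL_def)
qed

text \<open>Test functions are 1-Lipschitz and bounded by 1, so along a coupling their values differ by at most
  both the distance and 2. All \<open>d_BL\<close> estimates below are obtained by choosing a coupling.\<close>

lemma d_BL_coupling:
  assumes "prob_space \<Omega>" and [measurable]: "X \<in> borel_measurable \<Omega>" "Y \<in> borel_measurable \<Omega>"
  shows "d_BL (distr \<Omega> borel X) (distr \<Omega> borel Y) \<le> (\<integral>\<omega>. min 2 \<bar>X \<omega> - Y \<omega>\<bar> \<partial>\<Omega>)"
proof -
  interpret prob_space \<Omega> by fact
  have pm: "distr \<Omega> borel Z \<in> prob_measures" if "Z \<in> borel_measurable \<Omega>" for Z :: "'a \<Rightarrow> real"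
    using that by (auto simp: prob_measures_def real_distribution_def real_distribution_axioms_def
        intro: prob_space_distr)
  have "(SUP f \<in> BL1. \<bar>(\<integral>x. f x \<partial>distr \<Omega> borel X) - (\<integral>x. f x \<partial>distr \<Omega> borel Y)\<bar>)
      \<le> (\<integral>\<omega>. min 2 \<bar>X \<omega> - Y \<omega>\<bar> \<partial>\<Omega>)"
  proof (rule cSUP_least)
    show "BL1 \<noteq> {}" using BL1_zero by blast
    fix f assume f: "f \<in> BL1"
    then have "continuous_on UNIV f"
      by (auto simp: BL1_def intro: lipschitz_on_continuous_on)
    then have [measurable]: "f \<in> borel_measurable borel"
      by (rule borel_measurable_continuous_onI)
    have b: "\<bar>f x\<bar> \<le> 1" and l: "\<bar>f x - f y\<bar> \<le> \<bar>x - y\<bar>" for x y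
      using f by (auto simp: BL1_def lipschitz_on_def dist_real_def)
    have i: "integrable \<Omega> (\<lambda>\<omega>. f (X \<omega>))" "integrable \<Omega> (\<lambda>\<omega>. f (Y \<omega>))"
      by (rule integrable_const_bound[of _ 1]; use b in auto)+
    have "\<bar>(\<integral>x. f x \<partial>distr \<Omega> borel X) - (\<integral>x. f x \<partial>distr \<Omega> borel Y)\<bar>
        = \<bar>\<integral>\<omega>. f (X \<omega>) - f (Y \<omega>) \<partial>\<Omega>\<bar>"
      using i by (simp add: integral_distr)
    also have "\<dots> \<le> (\<integral>\<omega>. \<bar>f (X \<omega>) - f (Y \<omega>)\<bar> \<partial>\<Omega>)"
      by (rule integral_abs_bound)
    also have "\<dots> \<le> (\<integral>\<omega>. min 2 \<bar>X \<omega> - Y \<omega>\<bar> \<partial>\<Omega>)"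
    proof (rule integral_mono)
      show "integrable \<Omega> (\<lambda>\<omega>. \<bar>f (X \<omega>) - f (Y \<omega>)\<bar>)" using i by auto
      show "integrable \<Omega> (\<lambda>\<omega>. min 2 \<bar>X \<omega> - Y \<omega>\<bar>)"
        by (rule integrable_const_bound[of _ 2]) auto
      fix \<omega> show "\<bar>f (X \<omega>) - f (Y \<omega>)\<bar> \<le> min 2 \<bar>X \<omega> - Y \<omega>\<bar>"
        using l[of "X \<omega>" "Y \<omega>"] b[of "X \<omega>"] b[of "Y \<omega>"] by linarith
    qed
    finally show "\<bar>(\<integral>x. f x \<partial>distr \<Omega> borel X) - (\<integral>x. f x \<partial>distr \<Omega> borel Y)\<bar>
      \<le> (\<integral>\<omega>. min 2 \<bar>X \<omega> - Y \<omega>\<bar> \<partial>\<Omega>)" .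
  qed
  then show ?thesis
    using pm by (simp add: d_BL_def)
qed

lemma Skorohod_obtain:
  assumes "\<And>n. real_distribution (\<mu> n)" "real_distribution M" "weak_conv_m \<mu> M"
  obtains \<Omega> :: "real measure" and Y :: "nat \<Rightarrow> real \<Rightarrow> real" and Z :: "real \<Rightarrow> real"
  where "prob_space \<Omega>" "\<And>n. Y n \<in> borel_measurable \<Omega>" "Z \<in> borel_measurable \<Omega>"
    "\<And>n. distr \<Omega> borel (Y n) = \<mu> n" "distr \<Omega> borel Z = M"
    "\<And>x. x \<in> space \<Omega> \<Longrightarrow> (\<lambda>n. Y n x) \<longlonglongrightarrow> Z x"
proof -
  from Skorohod[OF assms] obtain \<Omega> :: "real measure" and Y :: "nat \<Rightarrow> real \<Rightarrow> real" and Z :: "real \<Rightarrow> real"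
    where "prob_space \<Omega> \<and>
    (\<forall>n. Y n \<in> measurable \<Omega> borel) \<and>
    (\<forall>n. distr \<Omega> borel (Y n) = \<mu> n) \<and>
    Z \<in> measurable \<Omega> lborel \<and>
    distr \<Omega> borel Z = M \<and>
    (\<forall>x \<in> space \<Omega>. (\<lambda>n. Y n x) \<longlonglongrightarrow> Z x)" by blast
  then show ?thesis using that[of \<Omega> Y Z] by simp
qed

text \<open>Skorohod's almost surely convergent coupling gives a bound that is uniform over all test functions
  at once, and dominated convergence sends it to 0.\<close>

lemma weak_conv_m_imp_d_BL:
  assumes "\<And>n. real_distribution (\<mu> n)" "real_distribution M" "weak_conv_m \<mu> M"
  shows "(\<lambda>n. d_BL (\<mu> n) M) \<longlonglongrightarrow> 0"
proof -
  from Skorohod_obtain[OF assms] obtain \<Omega> :: "real measure" and Y Z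
    where ps: "prob_space \<Omega>" and [measurable]: "\<And>n. Y n \<in> borel_measurable \<Omega>" "Z \<in> borel_measurable \<Omega>"
    and D: "\<And>n. distr \<Omega> borel (Y n) = \<mu> n" "distr \<Omega> borel Z = M"
    and lim: "\<And>x. x \<in> space \<Omega> \<Longrightarrow> (\<lambda>n. Y n x) \<longlonglongrightarrow> Z x" by metis
  interpret prob_space \<Omega> by fact
  have "(\<lambda>n. \<integral>\<omega>. min 2 \<bar>Y n \<omega> - Z \<omega>\<bar> \<partial>\<Omega>) \<longlonglongrightarrow> (\<integral>\<omega>. 0 \<partial>\<Omega>)"
  proof (rule integral_dominated_convergence[where w="\<lambda>_. 2"])
    show "AE x in \<Omega>. (\<lambda>i. min 2 \<bar>Y i x - Z x\<bar>) \<longlonglongrightarrow> 0"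
    proof (rule AE_I2)
      fix x assume "x \<in> space \<Omega>"
      then have "(\<lambda>i. min 2 \<bar>Y i x - Z x\<bar>) \<longlonglongrightarrow> min 2 \<bar>Z x - Z x\<bar>"
        by (intro tendsto_intros lim)
      then show "(\<lambda>i. min 2 \<bar>Y i x - Z x\<bar>) \<longlonglongrightarrow> 0" by simp
    qed
  qed auto
  then have l: "(\<lambda>n. \<integral>\<omega>. min 2 \<bar>Y n \<omega> - Z \<omega>\<bar> \<partial>\<Omega>) \<longlonglongrightarrow> 0" by simp
  have u: "d_BL (\<mu> n) M \<le> (\<integral>\<omega>. min 2 \<bar>Y n \<omega> - Z \<omega>\<bar> \<partial>\<Omega>)" for n
    using d_BL_coupling[OF ps, of "Y n" Z] D by simp
  show ?thesis
    by (rule tendsto_sandwich[OF _ _ tendsto_const l])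
       (use u Metric_space.nonneg[OF Metric_space_d_BL] in auto)
qed


section \<open>Symmetric measures\<close>

lemma prob_measures_iff: "\<mu> \<in> prob_measures \<longleftrightarrow> real_distribution \<mu>"
  by (simp add: prob_measures_def)

lemma sym_prob_measures_iff:
  "\<mu> \<in> sym_prob_measures \<longleftrightarrow> real_distribution \<mu> \<and> distr \<mu> borel uminus = \<mu>"
proof (cases "real_distribution \<mu>")
  case True
  then interpret real_distribution \<mu> .
  have im: "uminus ` B = uminus -` B" for B :: "real set" by force
  have [measurable]: "B \<in> sets borel \<Longrightarrow> uminus -` B \<in> sets (borel :: real measure)" for B
    using measurable_sets[of uminus borel borel B] by simp
  have d: "emeasure (distr \<mu> borel uminus) B = emeasure \<mu> (uminus ` B)" if "B \<in> sets borel" for B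
    using that by (simp add: emeasure_distr im)
  have "(\<forall>B\<in>sets borel. measure \<mu> B = measure \<mu> (uminus ` B)) \<longleftrightarrow> distr \<mu> borel uminus = \<mu>"
  proof
    assume *: "\<forall>B\<in>sets borel. measure \<mu> B = measure \<mu> (uminus ` B)"
    show "distr \<mu> borel uminus = \<mu>"
    proof (rule measure_eqI)
      fix B assume "B \<in> sets (distr \<mu> borel uminus)"
      then have B: "B \<in> sets borel" by simp
      from *[rule_format, OF B] have "emeasure \<mu> B = emeasure \<mu> (uminus ` B)"
        by (simp only: emeasure_eq_measure)
      then show "emeasure (distr \<mu> borel uminus) B = emeasure \<mu> B"
        using d[OF B] by simp
    qed simp
  next
    assume "distr \<mu> borel uminus = \<mu>"
    then show "\<forall>B\<in>sets borel. measure \<mu> B = measure \<mu> (uminus ` B)"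
      using d by (auto simp: measure_def)
  qed
  with True show ?thesis by (simp add: sym_prob_measures_def prob_measures_def)
qed (simp add: sym_prob_measures_def prob_measures_def)

text \<open>The map \<open>x \<mapsto> - x\<close> is continuous, so integrals of \<open>f\<close> and of \<open>f \<circ> uminus\<close>, which agree along the
  sequence, agree in the limit.\<close>

lemma weak_conv_m_sym:
  assumes "\<And>n. \<mu> n \<in> sym_prob_measures" "real_distribution M" "weak_conv_m \<mu> M"
  shows "M \<in> sym_prob_measures"
proof -
  have rd: "\<And>n. real_distribution (\<mu> n)" and sym: "\<And>n. distr (\<mu> n) borel uminus = \<mu> n"
    using assms(1) by (auto simp: sym_prob_measures_iff)
  interpret M: real_distribution M by fact
  have rdu: "real_distribution (distr M borel uminus)"
    by (auto simp: real_distribution_def real_distribution_axioms_def intro: M.prob_space_distr)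
  have "M = distr M borel uminus"
  proof (rule prob_measures_eqI)
    show "M \<in> prob_measures" "distr M borel uminus \<in> prob_measures"
      using assms(2) rdu by (simp_all add: prob_measures_iff)
    show "(\<integral>x. f x \<partial>M) = (\<integral>x. f x \<partial>distr M borel uminus)" if f: "f \<in> BL1" for f
    proof -
      have b: "\<bar>f x\<bar> \<le> 1" for x using f by (auto simp: BL1_def)
      have c: "continuous_on UNIV f" using f by (auto simp: BL1_def intro: lipschitz_on_continuous_on)
      then have C: "isCont f x" for x by (simp add: continuous_on_eq_continuous_at)
      have Cu: "isCont (\<lambda>x. f (- x)) x" for x
        by (rule isCont_o2[where f=uminus and g=f, OF _ C]) simp
      have [measurable]: "f \<in> borel_measurable borel" by (rule borel_measurable_continuous_onI[OF c])
      have L: "(\<lambda>n. \<integral>x. f x \<partial>\<mu> n) \<longlonglongrightarrow> (\<integral>x. f x \<partial>M)"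
        by (rule weak_conv_imp_integral_bdd_continuous_conv[OF rd assms(2,3), where B=1]) (use b C in auto)
      have Lu: "(\<lambda>n. \<integral>x. f (- x) \<partial>\<mu> n) \<longlonglongrightarrow> (\<integral>x. f (- x) \<partial>M)"
        by (rule weak_conv_imp_integral_bdd_continuous_conv[OF rd assms(2,3), where B=1]) (use b Cu in auto)
      have eq: "(\<integral>x. f (- x) \<partial>\<mu> n) = (\<integral>x. f x \<partial>\<mu> n)" for n
      proof -
        interpret m: real_distribution "\<mu> n" by (rule rd)
        show ?thesis by (subst (2) sym[symmetric], subst integral_distr) simp_all
      qed
      have "(\<integral>x. f (- x) \<partial>M) = (\<integral>x. f x \<partial>M)"
        using LIMSEQ_unique[OF Lu[unfolded eq] L] .
      then show ?thesis by (simp add: integral_distr)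
    qed
  qed
  then have "distr M borel uminus = M" by simp
  with assms(2) show ?thesis by (simp add: sym_prob_measures_iff)
qed

text \<open>Reduces integrals against a symmetric measure to the law of \<open>\<bar>x\<bar>\<close>.\<close>

lemma integral_even_part:
  fixes f :: "real \<Rightarrow> real"
  assumes \<mu>: "\<mu> \<in> sym_prob_measures" and [measurable]: "f \<in> borel_measurable borel" and b: "\<And>x. \<bar>f x\<bar> \<le> 1"
  shows "(\<integral>x. f x \<partial>\<mu>) = (\<integral>x. (f x + f (- x)) / 2 \<partial>\<mu>)"
proof -
  interpret real_distribution \<mu> using \<mu> by (simp add: sym_prob_measures_iff)
  have sym: "distr \<mu> borel uminus = \<mu>" using \<mu> by (simp add: sym_prob_measures_iff)
  have "integrable \<mu> f" "integrable \<mu> (\<lambda>x. f (- x))"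
    by (rule integrable_const_bound[where B=1]; use b in auto)+
  then have "(\<integral>x. (f x + f (- x)) / 2 \<partial>\<mu>) = ((\<integral>x. f x \<partial>\<mu>) + (\<integral>x. f (- x) \<partial>\<mu>)) / 2" by simp
  also have "(\<integral>x. f (- x) \<partial>\<mu>) = (\<integral>x. f x \<partial>distr \<mu> borel uminus)" by (subst integral_distr) auto
  finally show ?thesis by (simp add: sym)
qed

lemma openin_sym_weak_topology_iff:
  "openin sym_weak_topology U \<longleftrightarrow> U \<subseteq> sym_prob_measures \<and>
    (\<forall>\<mu>\<in>U. \<exists>r>0. \<forall>\<nu>\<in>sym_prob_measures. d_BL \<mu> \<nu> < r \<longrightarrow> \<nu> \<in> U)"
proof -
  interpret B: Metric_space prob_measures d_BL by (rule Metric_space_d_BL)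
  interpret S: Submetric prob_measures d_BL sym_prob_measures
    by unfold_locales (auto simp: sym_prob_measures_def)
  have eq: "sym_weak_topology = S.sub.mtopology"
    using S.mtopology_submetric by (simp add: sym_weak_topology_def weak_topology_def)
  show ?thesis
  proof (cases "U \<subseteq> sym_prob_measures")
    case True
    then have "S.sub.mball \<mu> r \<subseteq> U \<longleftrightarrow> (\<forall>\<nu>\<in>sym_prob_measures. d_BL \<mu> \<nu> < r \<longrightarrow> \<nu> \<in> U)" if "\<mu> \<in> U" for \<mu> r
      unfolding S.sub.mball_def using that by blast
    then have "(\<exists>r>0. S.sub.mball \<mu> r \<subseteq> U) \<longleftrightarrow> (\<exists>r>0. \<forall>\<nu>\<in>sym_prob_measures. d_BL \<mu> \<nu> < r \<longrightarrow> \<nu> \<in> U)"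
      if "\<mu> \<in> U" for \<mu>
      using that by simp
    then show ?thesis
      unfolding eq S.sub.openin_mtopology using True by blast
  next
    case False
    then show ?thesis unfolding eq S.sub.openin_mtopology by blast
  qed
qed

lemma Hausdorff_sym_weak_topology: "Hausdorff_space sym_weak_topology"
  unfolding sym_weak_topology_def weak_topology_def
  by (intro Hausdorff_space_subtopology Metric_space.Hausdorff_space_mtopology Metric_space_d_BL)

section \<open>Symmetrized empirical measures\<close>

text \<open>The symmetrized empirical measure is the law of \<open>\<plusminus> s\<^sub>i\<close> for a uniformly chosen index and sign. This
  gives integrals as finite averages and couples the measures of two configurations.\<close>

lemma sym_empirical_eq_distr:
  assumes "1 \<le> p"
  shows "sym_empirical p s =
    distr (measure_pmf (pmf_of_set ({1..p} \<times> {1, -1}))) borel (\<lambda>(i, e). e * s i)"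
proof (rule measure_eqI)
  have S: "sets (sym_empirical p s) = sets borel"
    unfolding sym_empirical_def using sets.sigma_sets_eq[of "borel :: real measure"] by simp
  then show "sets (sym_empirical p s) =
    sets (distr (measure_pmf (pmf_of_set ({1..p} \<times> {1, -1}))) borel (\<lambda>(i, e). e * s i))" by simp
  fix B assume "B \<in> sets (sym_empirical p s)"
  then have B: "B \<in> sets borel" using S by simp
  have half: "1 / 2 = ennreal (1 / 2)" and inv: "1 / of_nat p = ennreal (1 / real p)"
    using assms by (simp_all add: divide_ennreal ennreal_of_nat_eq_real_of_nat flip: ennreal_1 ennreal_numeral)
  have "emeasure (distr (measure_pmf (pmf_of_set ({1..p} \<times> {1, -1}))) borel (\<lambda>(i, e). e * s i)) B
      = (\<integral>\<^sup>+ z. ennreal (indicator B (case z of (i, e) \<Rightarrow> e * s i)) \<partial>measure_pmf (pmf_of_set ({1..p} \<times> {1, -1})))"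
    using B by (subst nn_integral_indicator[symmetric], simp, subst nn_integral_distr) (auto simp: ennreal_indicator)
  also have "\<dots> = ennreal ((\<Sum>z\<in>{1..p} \<times> {1, -1}. indicator B (case z of (i, e) \<Rightarrow> e * s i)) / real (2 * p))"
    using assms
    by (subst nn_integral_pmf_of_set)
       (auto simp: card_cartesian_product divide_ennreal[symmetric] sum_nonneg
          ennreal_of_nat_eq_real_of_nat mult.commute)
  also have "(\<Sum>z\<in>{1..p} \<times> {1, -1}. indicator B (case z of (i, e) \<Rightarrow> e * s i))
     = (\<Sum>i=1..p. indicator B (s i) + indicator B (- s i) :: real)"
    by (simp add: sum.cartesian_product')
  also have "\<dots> / real (2 * p) = 1 / real p * (\<Sum>i=1..p. 1/2 * indicator B (s i) + 1/2 * indicator B (- s i))"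
    by (simp flip: sum_divide_distrib add_divide_distrib)
  also have "ennreal \<dots> = 1 / of_nat p * (\<Sum>i = 1..p.
    1/2 * emeasure (return borel (s i)) B + 1/2 * emeasure (return borel (- s i)) B)"
  proof -
    have e: "1/2 * emeasure (return borel (s i)) B + 1/2 * emeasure (return borel (- s i)) B
        = ennreal (1/2 * indicator B (s i) + 1/2 * indicator B (- s i))" for i
    proof -
      have h: "0 \<le> (1/2 :: real)" by simp
      have "ennreal (1/2 * a + 1/2 * b) = ennreal (1/2) * ennreal a + ennreal (1/2) * ennreal b"
        if "0 \<le> a" "0 \<le> b" for a b :: real
        using that ennreal_plus[of "1/2 * a" "1/2 * b"] ennreal_mult[of "1/2" a] ennreal_mult[of "1/2" b]
        by (simp only: mult_nonneg_nonneg h)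
      then show ?thesis
        unfolding half emeasure_return[OF B] ennreal_indicator[symmetric] by simp
    qed
    show ?thesis
      unfolding e inv by (subst ennreal_mult, simp, simp add: sum_nonneg, subst sum_ennreal) simp_all
  qed
  finally show "emeasure (sym_empirical p s) B =
    emeasure (distr (measure_pmf (pmf_of_set ({1..p} \<times> {1, -1}))) borel (\<lambda>(i, e). e * s i)) B"
    using B by (simp add: emeasure_sym_empirical)
qed

lemma nn_integral_sym_empirical_even:
  fixes f :: "real \<Rightarrow> ennreal"
  assumes p: "1 \<le> p" and [measurable]: "f \<in> borel_measurable borel" and even: "\<And>x. f (- x) = f x"
  shows "(\<integral>\<^sup>+ x. f x \<partial>sym_empirical p s) = (\<Sum>i=1..p. f (s i)) / of_nat p"
proof -
  have "(\<integral>\<^sup>+ x. f x \<partial>sym_empirical p s)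
      = (\<Sum>z\<in>{1..p} \<times> {1, -1::real}. f (case z of (i, e) \<Rightarrow> e * s i)) / of_nat (card ({1..p} \<times> {1, -1::real}))"
    unfolding sym_empirical_eq_distr[OF p]
    using p by (subst nn_integral_distr, simp, simp, subst nn_integral_pmf_of_set)
      auto
  also have "card ({1..p} \<times> {1, -1::real}) = p * 2" by (simp add: card_cartesian_product)
  also have "(\<Sum>z\<in>{1..p} \<times> {1, -1::real}. f (case z of (i, e) \<Rightarrow> e * s i)) = (\<Sum>i=1..p. f (s i) * 2)"
    by (subst sum.cartesian_product') (simp add: even mult_2_right[symmetric])
  also have "\<dots> / of_nat (p * 2) = (\<Sum>i=1..p. f (s i)) / of_nat p"
    unfolding sum_distrib_right[symmetric] of_nat_mult of_nat_numeral by (rule divide_mult_eq) auto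
  finally show ?thesis .
qed

lemma integral_sym_empirical:
  fixes f :: "real \<Rightarrow> real"
  assumes p: "1 \<le> p" and [measurable]: "f \<in> borel_measurable borel"
  shows "(\<integral>x. f x \<partial>sym_empirical p s) = (\<Sum>i=1..p. (f (s i) + f (- s i)) / 2) / real p"
proof -
  have "(\<integral>x. f x \<partial>sym_empirical p s)
      = (\<Sum>z\<in>{1..p} \<times> {1, -1::real}. f (case z of (i, e) \<Rightarrow> e * s i)) / real (card ({1..p} \<times> {1, -1::real}))"
    unfolding sym_empirical_eq_distr[OF p]
    using p by (subst integral_distr, simp, simp, subst integral_pmf_of_set)
      auto
  also have "card ({1..p} \<times> {1, -1::real}) = p * 2" by (simp add: card_cartesian_product)
  also have "(\<Sum>z\<in>{1..p} \<times> {1, -1::real}. f (case z of (i, e) \<Rightarrow> e * s i)) = (\<Sum>i=1..p. f (s i) + f (- s i))"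
    by (simp add: sum.cartesian_product')
  finally show ?thesis by (simp add: sum_divide_distrib[symmetric])
qed

text \<open>The coupling uses the same index and the same sign for both configurations.\<close>

lemma d_BL_sym_empirical_le:
  assumes p: "1 \<le> p" and le: "\<And>i. i \<in> {1..p} \<Longrightarrow> \<bar>s i - t i\<bar> \<le> r"
  shows "d_BL (sym_empirical p s) (sym_empirical p t) \<le> r"
proof -
  let ?P = "measure_pmf (pmf_of_set ({1..p} \<times> {1, -1::real}))"
  have "d_BL (sym_empirical p s) (sym_empirical p t)
      \<le> (\<integral>z. min 2 \<bar>(case z of (i, e) \<Rightarrow> e * s i) - (case z of (i, e) \<Rightarrow> e * t i)\<bar> \<partial>?P)"
    unfolding sym_empirical_eq_distr[OF p] by (rule d_BL_coupling) (auto intro: prob_space_measure_pmf)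
  also have "\<dots> \<le> (\<integral>z. r \<partial>?P)"
  proof (rule integral_mono_AE)
    show "integrable ?P (\<lambda>z. min 2 \<bar>(case z of (i, e) \<Rightarrow> e * s i) - (case z of (i, e) \<Rightarrow> e * t i)\<bar>)"
      by (rule measure_pmf.integrable_const_bound[where B=2]) auto
    show "AE z in ?P. min 2 \<bar>(case z of (i, e) \<Rightarrow> e * s i) - (case z of (i, e) \<Rightarrow> e * t i)\<bar> \<le> r"
      using p le by (auto simp: AE_measure_pmf_iff min_le_iff_disj abs_minus_commute)
  qed auto
  finally show ?thesis by simp
qed

lemma sym_empirical_cong: "(\<And>i. i \<in> {1..p} \<Longrightarrow> s i = t i) \<Longrightarrow> sym_empirical p s = sym_empirical p t"
  unfolding sym_empirical_def by (intro arg_cong[where f="measure_of UNIV (sets borel)"] ext arg_cong2[where f="(*)"] refl sum.cong) simp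

text \<open>The map is continuous for the topology of pointwise convergence on all sequences
  \<open>nat \<Rightarrow> real\<close>, whose open sets are Borel for the product sigma-algebra; configurations are extended
  by 0 to make use of this.\<close>

lemma measurable_sym_empirical:
  assumes p: "1 \<le> p"
  shows "sym_empirical p \<in> lebesgue_vec p \<rightarrow>\<^sub>M borel_of sym_weak_topology"
proof -
  define ext :: "(nat \<Rightarrow> real) \<Rightarrow> nat \<Rightarrow> real" where "ext s i = (if i \<in> {1..p} then s i else 0)" for s i
  have ext_measurable: "ext \<in> lebesgue_vec p \<rightarrow>\<^sub>M (borel :: (nat \<Rightarrow> real) measure)"
  proof (rule measurable_coordinatewise_then_product)
    fix i show "(\<lambda>s. ext s i) \<in> borel_measurable (lebesgue_vec p)"
      unfolding ext_def lebesgue_vec_def by (cases "i \<in> {1..p}") auto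
  qed
  show ?thesis
    unfolding borel_of_def
  proof (rule measurable_measure_of)
    show "{U. openin sym_weak_topology U} \<subseteq> Pow (topspace sym_weak_topology)"
      by (auto dest: openin_subset)
    show "sym_empirical p \<in> space (lebesgue_vec p) \<rightarrow> topspace sym_weak_topology"
      using sym_empirical_prob[OF p] by (auto simp: topspace_sym_weak_topology)
    fix U assume "U \<in> {U. openin sym_weak_topology U}"
    then have U: "openin sym_weak_topology U" by simp
    have "open (sym_empirical p -` U)"
    proof (subst open_subopen, intro ballI)
      fix s assume "s \<in> sym_empirical p -` U"
      then obtain r where r: "r > 0"
        and *: "\<And>\<nu>. \<nu> \<in> sym_prob_measures \<Longrightarrow> d_BL (sym_empirical p s) \<nu> < r \<Longrightarrow> \<nu> \<in> U"
        using U by (auto simp: openin_sym_weak_topology_iff)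
      let ?T = "Pi\<^sub>E UNIV (\<lambda>i. if i \<in> {1..p} then ball (s i) (r/2) else UNIV)"
      have "open ?T"
      proof (rule open_PiE)
        show "open (if i \<in> {1..p} then ball (s i) (r / 2) else UNIV)" for i by auto
        show "finite {i. (if i \<in> {1..p} then ball (s i) (r / 2) else UNIV) \<noteq> UNIV}"
          by (rule finite_subset[of _ "{1..p}"]) auto
      qed
      moreover have "s \<in> ?T" using r by auto
      moreover have "?T \<subseteq> sym_empirical p -` U"
      proof
        fix t assume "t \<in> ?T"
        then have "\<bar>s i - t i\<bar> \<le> r/2" if "i \<in> {1..p}" for i
          using that by (auto simp: PiE_iff dist_real_def dest!: spec[of _ i])
        then have "d_BL (sym_empirical p s) (sym_empirical p t) \<le> r/2"
          by (rule d_BL_sym_empirical_le[OF p])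
        then show "t \<in> sym_empirical p -` U"
          using r by (auto intro!: * sym_empirical_prob p)
      qed
      ultimately show "\<exists>T. open T \<and> s \<in> T \<and> T \<subseteq> sym_empirical p -` U" by blast
    qed
    then have "ext -` (sym_empirical p -` U) \<inter> space (lebesgue_vec p) \<in> sets (lebesgue_vec p)"
      by (rule measurable_sets[OF ext_measurable borel_open])
    moreover have "sym_empirical p (ext s) = sym_empirical p s" for s
      by (rule sym_empirical_cong) (simp add: ext_def)
    ultimately show "sym_empirical p -` U \<inter> space (lebesgue_vec p) \<in> sets (lebesgue_vec p)"
      by (simp add: vimage_def)
  qed
qed

section \<open>The potential and the rate function\<close>

abbreviation log_potential :: "real \<Rightarrow> real" where "log_potential x \<equiv> x\<^sup>2 - ln (x\<^sup>2)"

text \<open>The integrand of \<^const>\<open>I_sym\<close>. With values in \<open>[0, \<infinity>]\<close> and value \<open>\<infinity>\<close> at 0 it is continuous on the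
  whole line.\<close>

definition potential :: "real \<Rightarrow> ennreal" where
  "potential x = e2ennreal (ereal (x\<^sup>2) - ext_ln (x\<^sup>2))"

lemma potential_0 [simp]: "potential 0 = top"
  by (simp add: potential_def ext_ln_def)

lemma potential_nonzero: "x \<noteq> 0 \<Longrightarrow> potential x = ennreal (x\<^sup>2 - ln (x\<^sup>2))"
  by (simp add: potential_def ext_ln_def)

lemma log_potential_ge_1: "x \<noteq> 0 \<Longrightarrow> 1 \<le> log_potential x"
  using ln_le_minus_one[of "x\<^sup>2"] by simp

text \<open>Half of \<open>x\<^sup>2\<close> suffices to dominate \<open>ln (x\<^sup>2)\<close>; the other half controls second moments.\<close>

lemma log_potential_ge_half_sq: "x \<noteq> 0 \<Longrightarrow> x\<^sup>2 / 2 \<le> log_potential x"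
proof -
  assume x: "x \<noteq> 0"
  have "ln (x\<^sup>2) = ln (x\<^sup>2 / 2) + ln 2" using x by (simp add: ln_div)
  also have "\<dots> \<le> (x\<^sup>2 / 2 - 1) + (2 - 1)"
    using x by (intro add_mono ln_le_minus_one) auto
  finally show ?thesis by simp
qed

lemma potential_ge_1: "1 \<le> potential x"
  by (cases "x = 0") (use log_potential_ge_1[of x] in \<open>auto simp: potential_nonzero ennreal_le_iff2 simp flip: ennreal_1\<close>)

lemma potential_ge_half_sq: "ennreal (x\<^sup>2 / 2) \<le> potential x"
  by (cases "x = 0") (use log_potential_ge_half_sq[of x] in \<open>auto simp: potential_nonzero intro: ennreal_leI\<close>)

lemma potential_uminus [simp]: "potential (- x) = potential x"
  by (simp add: potential_def)

lemma isCont_potential: "isCont potential x"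
proof (cases "x = 0")
  case True
  have "LIM x at 0. (x::real)\<^sup>2 - ln (x\<^sup>2) :> at_top"
    by real_asymp
  then have "((\<lambda>x::real. ennreal (x\<^sup>2 - ln (x\<^sup>2))) \<longlongrightarrow> top) (at 0)"
    by (simp add: ennreal_tendsto_top_eq_at_top)
  then have "(potential \<longlongrightarrow> top) (at 0)"
    by (rule Lim_transform_eventually) (auto simp: eventually_at_filter potential_nonzero)
  then show ?thesis using True by (simp add: isCont_def)
next
  case False
  have "((\<lambda>x. ennreal (x\<^sup>2 - ln (x\<^sup>2))) \<longlongrightarrow> ennreal (x\<^sup>2 - ln (x\<^sup>2))) (at x)"
    using False by (intro tendsto_intros) auto
  moreover have "\<forall>\<^sub>F y in at x. y \<noteq> 0"
    using False by (metis eventually_neq_at_within)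
  ultimately have "(potential \<longlongrightarrow> ennreal (x\<^sup>2 - ln (x\<^sup>2))) (at x)"
    by (elim Lim_transform_eventually) (auto elim!: eventually_mono simp: potential_nonzero)
  then show ?thesis using False by (simp add: isCont_def potential_nonzero)
qed

lemma measurable_potential [measurable]: "potential \<in> borel_measurable borel"
  by (intro borel_measurable_continuous_onI continuous_at_imp_continuous_on ballI isCont_potential)

lemma I_sym_eq: "I_sym \<mu> = enn2ereal (\<integral>\<^sup>+ x. potential x \<partial>\<mu>) - 1"
  by (simp add: I_sym_def potential_def)

lemma I_sym_le_iff:
  assumes "0 \<le> C + 1"
  shows "I_sym \<mu> \<le> ereal C \<longleftrightarrow> (\<integral>\<^sup>+ x. potential x \<partial>\<mu>) \<le> ennreal (C + 1)"
proof (cases "\<integral>\<^sup>+ x. potential x \<partial>\<mu>")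
  case (real r)
  then show ?thesis using assms by (auto simp: I_sym_eq one_ereal_def)
next
  case top
  then show ?thesis by (auto simp: I_sym_eq top_unique)
qed

lemma nn_integral_potential_ge_1:
  assumes "\<mu> \<in> prob_measures"
  shows "1 \<le> (\<integral>\<^sup>+ x. potential x \<partial>\<mu>)"
proof -
  interpret real_distribution \<mu> using assms by (simp add: prob_measures_def)
  have "1 = (\<integral>\<^sup>+ x. 1 \<partial>\<mu>)" using emeasure_space_1 by simp
  also have "\<dots> \<le> (\<integral>\<^sup>+ x. potential x \<partial>\<mu>)"
    by (intro nn_integral_mono potential_ge_1)
  finally show ?thesis .
qed

lemma I_sym_nonneg:
  assumes "\<mu> \<in> prob_measures"
  shows "0 \<le> I_sym \<mu>"
proof (cases "\<integral>\<^sup>+ x. potential x \<partial>\<mu>")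
  case (real r)
  then show ?thesis using nn_integral_potential_ge_1[OF assms]
    by (auto simp: I_sym_eq one_ereal_def simp flip: ennreal_1)
qed (simp add: I_sym_eq)

text \<open>Fatou's lemma along a Skorohod coupling.\<close>

lemma nn_integral_potential_lsc:
  assumes "\<And>n. real_distribution (\<mu> n)" "real_distribution M" "weak_conv_m \<mu> M"
    and le: "\<And>n. (\<integral>\<^sup>+ x. potential x \<partial>\<mu> n) \<le> K"
  shows "(\<integral>\<^sup>+ x. potential x \<partial>M) \<le> K"
proof -
  from Skorohod_obtain[OF assms(1-3)] obtain \<Omega> :: "real measure" and Y Z
    where ps: "prob_space \<Omega>" and [measurable]: "\<And>n. Y n \<in> borel_measurable \<Omega>" "Z \<in> borel_measurable \<Omega>"
    and D: "\<And>n. \<mu> n = distr \<Omega> borel (Y n)" "M = distr \<Omega> borel Z"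
    and lim: "\<And>x. x \<in> space \<Omega> \<Longrightarrow> (\<lambda>n. Y n x) \<longlonglongrightarrow> Z x" by metis
  have l: "liminf (\<lambda>n. potential (Y n x)) = potential (Z x)" if "x \<in> space \<Omega>" for x
    by (intro lim_imp_Liminf isCont_tendsto_compose[OF isCont_potential lim] that) simp
  have "(\<integral>\<^sup>+ x. potential x \<partial>M) = (\<integral>\<^sup>+ x. liminf (\<lambda>n. potential (Y n x)) \<partial>\<Omega>)"
    unfolding D(2) by (subst nn_integral_distr) (auto simp: l intro!: nn_integral_cong)
  also have "\<dots> \<le> liminf (\<lambda>n. \<integral>\<^sup>+ x. potential (Y n x) \<partial>\<Omega>)"
    by (rule nn_integral_liminf) auto
  also have "\<dots> = liminf (\<lambda>n. \<integral>\<^sup>+ x. potential x \<partial>\<mu> n)"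
    by (simp add: D(1) nn_integral_distr)
  also have "\<dots> \<le> liminf (\<lambda>n::nat. K)"
    by (intro Liminf_mono always_eventually allI le)
  also have "\<dots> = K" by (simp add: Liminf_const)
  finally show ?thesis .
qed

text \<open>Chebyshev's inequality with the second moment, which the potential controls.\<close>

lemma tight_of_potential_bound:
  assumes rd: "\<And>n. real_distribution (\<mu> n)" and le: "\<And>n. (\<integral>\<^sup>+ x. potential x \<partial>\<mu> n) \<le> ennreal K"
  shows "tight \<mu>"
  unfolding tight_def
proof (intro conjI allI impI rd)
  fix \<epsilon> :: real assume \<epsilon>: "0 < \<epsilon>"
  \<comment> \<open>Chosen so that the potential is at least \<open>(\<bar>K\<bar> + 1) / \<epsilon>\<close> outside \<open>[-R, R]\<close>.\<close>
  define R where "R = sqrt (2 * (\<bar>K\<bar> + 1) / \<epsilon>)"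
  have R: "R > 0" "R\<^sup>2 / 2 = (\<bar>K\<bar> + 1) / \<epsilon>" using \<epsilon> by (auto simp: R_def field_simps)
  have "measure (\<mu> n) {-R<..R} > 1 - \<epsilon>" for n
  proof -
    interpret real_distribution "\<mu> n" by (rule rd)
    have "ennreal (R\<^sup>2 / 2) * emeasure (\<mu> n) (- {-R<..R}) = (\<integral>\<^sup>+ x. ennreal (R\<^sup>2 / 2) * indicator (- {-R<..R}) x \<partial>\<mu> n)"
      by (subst nn_integral_cmult_indicator) auto
    also have "\<dots> \<le> (\<integral>\<^sup>+ x. potential x \<partial>\<mu> n)"
    proof (rule nn_integral_mono)
      fix x
      have "R\<^sup>2 / 2 \<le> x\<^sup>2 / 2" if "x \<notin> {-R<..R}"
        using that R(1) by (auto simp: abs_le_square_iff[symmetric])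
      then have "ennreal (R\<^sup>2 / 2) \<le> potential x" if "x \<notin> {-R<..R}"
        using that potential_ge_half_sq[of x] ennreal_leI order_trans by blast
      then show "ennreal (R\<^sup>2 / 2) * indicator (- {-R<..R}) x \<le> potential x"
        by (auto simp del: greaterThanAtMost_iff split: split_indicator)
    qed
    also have "\<dots> \<le> ennreal K" by (rule le)
    finally have "R\<^sup>2 / 2 * prob (- {-R<..R}) \<le> max 0 K"
      by (auto simp: emeasure_eq_measure ennreal_mult[symmetric] ennreal_le_iff2 max_def split: if_splits)
    then have "(\<bar>K\<bar> + 1) * prob (- {-R<..R}) \<le> \<epsilon> * max 0 K" using R \<epsilon> by (simp add: field_simps)
    also have "\<dots> < \<epsilon> * (\<bar>K\<bar> + 1)" using \<epsilon> by (intro mult_strict_left_mono) auto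
    finally have "prob (- {-R<..R}) * (\<bar>K\<bar> + 1) < \<epsilon> * (\<bar>K\<bar> + 1)" by (simp only: mult.commute)
    then have "prob (- {-R<..R}) < \<epsilon>" by (rule mult_right_less_imp_less) simp
    moreover have "prob (- {-R<..R}) = 1 - prob {-R<..R}"
      using prob_compl[of "{-R<..R}"] by (simp add: Compl_eq_Diff_UNIV)
    ultimately show ?thesis by simp
  qed
  then show "\<exists>a b. a < b \<and> (\<forall>n. 1 - \<epsilon> < measure (\<mu> n) {a<..b})"
    using R(1) by (intro exI[of _ "-R"] exI[of _ R]) auto
qed

text \<open>A tight sequence has a weakly convergent subsequence by Helly's theorem; symmetry and the bound on
  the potential pass to its limit, and the convergence holds in \<open>d_BL\<close>.\<close>

lemma compactin_I_sym_sublevel: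
  assumes C: "0 \<le> C"
  shows "compactin sym_weak_topology {\<mu> \<in> sym_prob_measures. I_sym \<mu> \<le> ereal C}" (is "compactin _ ?S")
proof -
  interpret B: Metric_space prob_measures d_BL by (rule Metric_space_d_BL)
  have sub: "?S \<subseteq> prob_measures" by (auto simp: sym_prob_measures_def)
  have "compactin B.mtopology ?S"
    unfolding B.compactin_sequentially
  proof (intro conjI allI impI sub)
    fix \<sigma> :: "nat \<Rightarrow> real measure" assume \<sigma>: "range \<sigma> \<subseteq> ?S"
    then have sym: "\<sigma> n \<in> sym_prob_measures" and le: "(\<integral>\<^sup>+ x. potential x \<partial>\<sigma> n) \<le> ennreal (C + 1)" for n
      using I_sym_le_iff[of C "\<sigma> n"] C by auto
    then have rd: "real_distribution (\<sigma> n)" for n by (simp add: sym_prob_measures_iff)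
    obtain r M where r: "strict_mono (r :: nat \<Rightarrow> nat)" and M: "real_distribution M"
      and w: "weak_conv_m (\<sigma> \<circ> r) M"
      using tight_imp_convergent_subsubsequence[OF tight_of_potential_bound[of \<sigma>, OF rd le], where s="\<lambda>n. n"]
      by (auto simp: strict_mono_def o_def)
    have "M \<in> sym_prob_measures"
      by (rule weak_conv_m_sym[OF _ M w]) (simp add: sym)
    moreover have "(\<integral>\<^sup>+ x. potential x \<partial>M) \<le> ennreal (C + 1)"
      by (rule nn_integral_potential_lsc[OF _ M w]) (simp_all add: rd le)
    ultimately have "M \<in> ?S" using C by (simp add: I_sym_le_iff)
    moreover have "limitin B.mtopology (\<sigma> \<circ> r) M sequentially"
      unfolding B.limitin_metric_dist_null
      using weak_conv_m_imp_d_BL[OF _ M w] rd M by (auto simp: prob_measures_iff)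
    ultimately show "\<exists>l r. l \<in> ?S \<and> strict_mono r \<and> limitin B.mtopology (\<sigma> \<circ> r) l sequentially"
      using r by blast
  qed
  then show ?thesis
    by (auto simp: sym_weak_topology_def weak_topology_def compactin_subtopology)
qed

text \<open>Lower semicontinuity is closedness of the sublevel sets, which are compact in a Hausdorff space.\<close>

lemma rate_function_I_sym: "rate_function sym_weak_topology I_sym"
  unfolding rate_function_def lower_semicontinuous_def topspace_sym_weak_topology
proof (intro conjI ballI allI impI)
  show pos: "0 \<le> I_sym \<mu>" if "\<mu> \<in> sym_prob_measures" for \<mu>
    using that by (intro I_sym_nonneg) (simp add: sym_prob_measures_def)
  fix \<mu> c assume \<mu>: "\<mu> \<in> sym_prob_measures" and c: "c < I_sym \<mu>"
  show "\<exists>U. openin sym_weak_topology U \<and> \<mu> \<in> U \<and> (\<forall>\<nu>\<in>U. c < I_sym \<nu>)"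
  proof (cases "0 \<le> c")
    case True
    then obtain C where C: "c = ereal C" "0 \<le> C" using c by (cases c) auto
    let ?K = "{\<mu> \<in> sym_prob_measures. I_sym \<mu> \<le> ereal C}"
    have "closedin sym_weak_topology ?K"
      by (rule compactin_imp_closedin[OF Hausdorff_sym_weak_topology compactin_I_sym_sublevel[OF C(2)]])
    then have "openin sym_weak_topology (sym_prob_measures - ?K)"
      using openin_diff openin_topspace topspace_sym_weak_topology by metis
    then show ?thesis using \<mu> c by (intro exI[of _ "sym_prob_measures - ?K"]) (auto simp: C)
  next
    case False
    then show ?thesis
      using \<mu> pos openin_topspace[of sym_weak_topology]
      by (intro exI[of _ sym_prob_measures]) (auto simp: topspace_sym_weak_topology not_le intro: less_le_trans[of c 0])
  qed
qed

lemma good_rate_function_I_sym: "good_rate_function sym_weak_topology I_sym"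
  using rate_function_I_sym compactin_I_sym_sublevel
  by (simp add: good_rate_function_def topspace_sym_weak_topology)

lemma I_sym_sym_empirical_le_iff:
  assumes p: "1 \<le> p" and C: "0 \<le> C + 1" and s: "\<And>i. i \<in> {1..p} \<Longrightarrow> s i \<noteq> 0"
  shows "I_sym (sym_empirical p s) \<le> ereal C \<longleftrightarrow> (\<Sum>i=1..p. (s i)\<^sup>2 - ln ((s i)\<^sup>2)) \<le> real p * (C + 1)"
proof -
  have pos: "0 \<le> (s i)\<^sup>2 - ln ((s i)\<^sup>2)" if "i \<in> {1..p}" for i
    using log_potential_ge_1[of "s i"] s[OF that] by simp
  have "(\<integral>\<^sup>+ x. potential x \<partial>sym_empirical p s) = (\<Sum>i=1..p. ennreal ((s i)\<^sup>2 - ln ((s i)\<^sup>2))) / of_nat p"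
    using p by (subst nn_integral_sym_empirical_even)
      (auto simp: potential_nonzero s intro!: sum.cong arg_cong2[where f="(/)"])
  also have "\<dots> = ennreal ((\<Sum>i=1..p. (s i)\<^sup>2 - ln ((s i)\<^sup>2)) / real p)"
    unfolding ennreal_of_nat_eq_real_of_nat
    using p by (subst sum_ennreal[OF pos], simp, subst divide_ennreal) (auto intro!: sum_nonneg pos)
  finally show ?thesis
    using p C pos by (simp add: I_sym_le_iff ennreal_le_iff divide_le_eq mult.commute)
qed

section \<open>The minimizer\<close>

lemma potential_le_1_iff: "potential x \<le> 1 \<longleftrightarrow> x = 1 \<or> x = - 1"
proof
  assume p: "potential x \<le> 1"
  then have x: "x \<noteq> 0" by (auto simp: top_unique)
  with p have "x\<^sup>2 - ln (x\<^sup>2) \<le> 1" by (simp add: potential_nonzero flip: ennreal_1)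
  then have "ln (x\<^sup>2) = x\<^sup>2 - 1" using log_potential_ge_1[of x] x by simp
  then have "x\<^sup>2 = 1" using x by (intro ln_eq_minus_one) auto
  then show "x = 1 \<or> x = - 1" by (simp add: power2_eq_1_iff)
qed (auto simp: potential_nonzero)

text \<open>If the integral of a function that is at least 1 equals 1, then the function is 1 almost everywhere,
  so \<open>\<mu>\<close> is carried by \<open>{-1, 1}\<close>. The even part of a test function is constant on this set, hence all
  integrals coincide with those against the Rademacher distribution.\<close>

lemma I_sym_le_0_iff:
  assumes \<mu>: "\<mu> \<in> sym_prob_measures"
  shows "I_sym \<mu> \<le> 0 \<longleftrightarrow> \<mu> = rademacher"
proof
  interpret real_distribution \<mu> using \<mu> by (simp add: sym_prob_measures_iff)
  assume "I_sym \<mu> \<le> 0"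
  then have le: "(\<integral>\<^sup>+ x. potential x \<partial>\<mu>) \<le> 1" using I_sym_le_iff[of 0 \<mu>] by (simp add: zero_ereal_def)
  have "(\<integral>\<^sup>+ x. potential x - 1 \<partial>\<mu>) = (\<integral>\<^sup>+ x. potential x \<partial>\<mu>) - (\<integral>\<^sup>+ x. 1 \<partial>\<mu>)"
    by (rule nn_integral_diff) (auto simp: potential_ge_1 emeasure_space_1[simplified])
  also have "(\<integral>\<^sup>+ x. potential x \<partial>\<mu>) = 1"
    using le \<mu> by (intro antisym nn_integral_potential_ge_1) (auto simp: sym_prob_measures_def)
  also have "1 - (\<integral>\<^sup>+ x. 1 \<partial>\<mu>) = (0::ennreal)" using emeasure_space_1 by simp
  finally have "AE x in \<mu>. potential x - 1 = 0" by (subst (asm) nn_integral_0_iff_AE) auto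
  then have AE: "AE x in \<mu>. x = 1 \<or> x = - 1"
    by eventually_elim (simp add: diff_eq_0_iff_ennreal potential_le_1_iff)
  show "\<mu> = rademacher"
    unfolding rademacher_def sym_dirac_eq
  proof (rule prob_measures_eqI)
    show "\<mu> \<in> prob_measures" using \<mu> by (simp add: sym_prob_measures_def)
    show "sym_empirical 1 (\<lambda>_. 1) \<in> prob_measures"
      using sym_empirical_prob[of 1] by (simp add: sym_prob_measures_def)
    fix f assume f: "f \<in> BL1"
    then have [measurable]: "f \<in> borel_measurable borel"
      by (auto simp: BL1_def intro!: borel_measurable_continuous_onI lipschitz_on_continuous_on)
    have "(\<integral>x. f x \<partial>\<mu>) = (\<integral>x. (f x + f (- x)) / 2 \<partial>\<mu>)"
      using f by (intro integral_even_part \<mu>) (auto simp: BL1_def)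
    also have "\<dots> = (\<integral>x. (f 1 + f (- 1)) / 2 \<partial>\<mu>)"
      by (rule integral_cong_AE) (use AE in \<open>auto elim!: eventually_mono\<close>)
    also have "\<dots> = (\<integral>x. f x \<partial>sym_empirical 1 (\<lambda>_. 1))"
      using prob_space by (simp add: integral_sym_empirical)
    finally show "(\<integral>x. f x \<partial>\<mu>) = (\<integral>x. f x \<partial>sym_empirical 1 (\<lambda>_. 1))" .
  qed
next
  assume "\<mu> = rademacher"
  then show "I_sym \<mu> \<le> 0"
    using I_sym_sym_empirical_le_iff[of 1 0 "\<lambda>_. 1"] by (simp add: rademacher_def sym_dirac_eq zero_ereal_def)
qed

lemma rademacher_sym: "rademacher \<in> sym_prob_measures"
  unfolding rademacher_def sym_dirac_eq by (rule sym_empirical_prob) simp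

lemma is_arg_min_I_sym_iff:
  "is_arg_min I_sym (\<lambda>\<nu>. \<nu> \<in> sym_prob_measures) \<mu> \<longleftrightarrow> \<mu> = rademacher"
proof -
  have nn: "0 \<le> I_sym \<nu>" if "\<nu> \<in> sym_prob_measures" for \<nu>
    using that by (intro I_sym_nonneg) (simp add: sym_prob_measures_def)
  have r: "I_sym rademacher \<le> 0" using I_sym_le_0_iff[OF rademacher_sym] by simp
  show ?thesis
  proof
    assume m: "is_arg_min I_sym (\<lambda>\<nu>. \<nu> \<in> sym_prob_measures) \<mu>"
    then have \<mu>: "\<mu> \<in> sym_prob_measures" and "\<not> I_sym rademacher < I_sym \<mu>"
      using rademacher_sym by (auto simp: is_arg_min_def)
    then have "I_sym \<mu> \<le> 0" using r by (auto simp: not_less intro: order_trans)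
    then show "\<mu> = rademacher" using I_sym_le_0_iff[OF \<mu>] by simp
  next
    assume "\<mu> = rademacher"
    then show "is_arg_min I_sym (\<lambda>\<nu>. \<nu> \<in> sym_prob_measures) \<mu>"
      using rademacher_sym r nn unfolding is_arg_min_def by (auto simp: not_less intro: order_trans)
  qed
qed

section \<open>Vandermonde products\<close>

text \<open>Every index occurs in \<open>p - 1\<close> pairs. The index pairs above and below the diagonal together
  form a part of the square, and the factors are at least 1.\<close>

lemma prod_pairs_le:
  fixes F :: "nat \<Rightarrow> nat \<Rightarrow> real"
  assumes F: "\<And>i j. 1 \<le> i \<Longrightarrow> i < j \<Longrightarrow> j \<le> p \<Longrightarrow> 0 \<le> F i j \<and> F i j \<le> c i * c j"
    and c: "\<And>i. i \<in> {1..p} \<Longrightarrow> 1 \<le> c i"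
  shows "(\<Prod>(i, j) \<in> {(i, j). 1 \<le> i \<and> i < j \<and> j \<le> p}. F i j) \<le> (\<Prod>i=1..p. c i ^ p)"
proof -
  let ?L = "{(i, j). 1 \<le> i \<and> i < j \<and> j \<le> p}" and ?G = "{(i, j). 1 \<le> j \<and> j < i \<and> i \<le> p}"
  have fin: "finite ?L" "finite ?G"
    by (rule finite_subset[of _ "{1..p} \<times> {1..p}"]; force)+
  have "(\<Prod>(i, j) \<in> ?L. F i j) \<le> (\<Prod>(i, j) \<in> ?L. c i * c j)"
    by (rule prod_mono) (use F in auto)
  also have "\<dots> = (\<Prod>(i, j) \<in> ?L. c i) * (\<Prod>(i, j) \<in> ?L. c j)"
    by (simp add: prod.distrib case_prod_beta)
  also have "(\<Prod>(i, j) \<in> ?L. c j) = (\<Prod>(i, j) \<in> ?G. c i)"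
    by (rule prod.reindex_bij_witness[of _ prod.swap prod.swap]) auto
  also have "(\<Prod>(i, j) \<in> ?L. c i) * (\<Prod>(i, j) \<in> ?G. c i) = (\<Prod>(i, j) \<in> ?L \<union> ?G. c i)"
    by (rule prod.union_disjoint[symmetric]) (use fin in auto)
  also have "\<dots> \<le> (\<Prod>(i, j) \<in> {1..p} \<times> {1..p}. c i)"
  proof (rule prod_mono2)
    show "?L \<union> ?G \<subseteq> {1..p} \<times> {1..p}" by auto
  qed (use c in \<open>auto intro: order_trans[OF zero_le_one]\<close>)
  also have "\<dots> = (\<Prod>i=1..p. c i ^ p)"
    by (simp add: prod.cartesian_product[symmetric])
  finally show ?thesis .
qed

text \<open>A single term of the exponential series is at most its sum.\<close>

lemma factorial_ge_exp:
  fixes x :: real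
  assumes "0 \<le> x" shows "x ^ k * exp (- x) \<le> fact k"
proof -
  have "x ^ k / fact k \<le> (\<Sum>n. x ^ n / fact n)"
    using sum_le_suminf[OF summable_exp[of x], of "{k}"] assms by (simp add: divide_inverse mult.commute)
  also have "\<dots> = exp x" by (simp add: exp_def divide_inverse mult.commute)
  finally show ?thesis by (simp add: exp_minus field_simps)
qed

text \<open>Equally spaced points with spacing of order \<open>1 / p\<close> have a Vandermonde product of order
  \<open>exp (- O(p\<^sup>2))\<close>: the gaps from the \<open>j\<close>-th point to the earlier ones multiply to \<open>(j - 1)! / p ^ (j - 1)\<close>, and this
  is at least \<open>exp (- p)\<close>, without a factor \<open>ln p\<close> in the exponent.\<close>

lemma prod_pairs_ge:
  fixes F :: "nat \<Rightarrow> nat \<Rightarrow> real"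
  assumes F: "\<And>i j. 1 \<le> i \<Longrightarrow> i < j \<Longrightarrow> j \<le> p \<Longrightarrow> \<kappa> * (real j - real i) / real p \<le> F i j"
    and \<kappa>: "0 < \<kappa>" "\<kappa> \<le> 1"
  shows "(\<kappa> ^ p * exp (- real p)) ^ p \<le> (\<Prod>(i, j) \<in> {(i, j). 1 \<le> i \<and> i < j \<and> j \<le> p}. F i j)"
proof -
  let ?L = "{(i, j). 1 \<le> i \<and> i < j \<and> j \<le> p}"
  have row: "\<kappa> ^ p * exp (- real p) \<le> (\<Prod>i=1..<j. \<kappa> * (real j - real i) / real p)"
    if j: "j \<in> {1..p}" for j
  proof -
    have p: "p > 0" using j by auto
    have "(\<Prod>i=1..<j. real j - real i) = (\<Prod>i=1..<j. real i)"
      by (rule prod.reindex_bij_witness[of _ "\<lambda>i. j - i" "\<lambda>i. j - i"]) (auto simp: of_nat_diff)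
    also have "\<dots> = (\<Prod>i=1..j-1. real i)" using j by (intro prod.cong) auto
    also have "\<dots> = fact (j - 1)" by (simp add: fact_prod)
    finally have 1: "(\<Prod>i=1..<j. real j - real i) = fact (j - 1)" .
    have "(\<Prod>i=1..<j. \<kappa> * (real j - real i) / real p) = \<kappa> ^ (j - 1) * fact (j - 1) / real p ^ (j - 1)"
      unfolding prod_dividef prod.distrib 1 by simp
    moreover have "\<kappa> ^ p \<le> \<kappa> ^ (j - 1)" using j \<kappa> by (intro power_decreasing) auto
    moreover have "exp (- real p) \<le> fact (j - 1) / real p ^ (j - 1)"
      using factorial_ge_exp[of "real p" "j - 1"] p by (simp add: field_simps)
    ultimately show ?thesis using \<kappa> by (simp add: mult_mono flip: times_divide_eq_right)
  qed
  have "(\<kappa> ^ p * exp (- real p)) ^ p = (\<Prod>j=1..p. \<kappa> ^ p * exp (- real p))" by simp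
  also have "\<dots> \<le> (\<Prod>j=1..p. \<Prod>i=1..<j. \<kappa> * (real j - real i) / real p)"
    by (rule prod_mono) (use row \<kappa> in auto)
  also have "\<dots> = (\<Prod>(j, i) \<in> Sigma {1..p} (\<lambda>j. {1..<j}). \<kappa> * (real j - real i) / real p)"
    by (rule prod.Sigma) auto
  also have "\<dots> = (\<Prod>(i, j) \<in> ?L. \<kappa> * (real j - real i) / real p)"
    by (rule prod.reindex_bij_witness[of _ prod.swap prod.swap]) auto
  also have "\<dots> \<le> (\<Prod>(i, j) \<in> ?L. F i j)"
    by (rule prod_mono) (use F \<kappa> in auto)
  finally show ?thesis .
qed

section \<open>The weight of a set of configurations\<close>

lemma measurable_sv_weight [measurable]: "sv_weight p n \<in> borel_measurable (lebesgue_vec p)"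
proof -
  have fin: "finite {(i, j). 1 \<le> i \<and> i < j \<and> j \<le> p}"
    by (rule finite_subset[of _ "{1..p} \<times> {1..p}"]) auto
  have m: "(\<lambda>s. s i) \<in> borel_measurable (lebesgue_vec p)" if "i \<in> {1..p}" for i
    unfolding lebesgue_vec_def using that by simp
  have "(\<lambda>s. \<Prod>x \<in> {(i, j). 1 \<le> i \<and> i < j \<and> j \<le> p}. case x of (i, j) \<Rightarrow> \<bar>(s i)\<^sup>2 - (s j)\<^sup>2\<bar>\<^sup>2)
      \<in> borel_measurable (lebesgue_vec p)"
  proof (rule borel_measurable_prod)
    fix x assume "x \<in> {(i, j). 1 \<le> i \<and> i < j \<and> j \<le> p}"
    then obtain i j where x: "x = (i, j)" and ij: "i \<in> {1..p}" "j \<in> {1..p}" by auto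
    note m[OF ij(1), measurable] m[OF ij(2), measurable]
    show "(\<lambda>s. case x of (i, j) \<Rightarrow> \<bar>(s i)\<^sup>2 - (s j)\<^sup>2\<bar>\<^sup>2) \<in> borel_measurable (lebesgue_vec p)"
      unfolding x by simp
  qed
  moreover have "(\<lambda>s. \<Prod>i = 1..p. s i ^ (2 * (n - p) + 1)) \<in> borel_measurable (lebesgue_vec p)"
    by (intro borel_measurable_prod borel_measurable_power m)
  moreover have "(\<lambda>s. \<Prod>i = 1..p. exp (- real n * (s i)\<^sup>2)) \<in> borel_measurable (lebesgue_vec p)"
  proof (rule borel_measurable_prod)
    fix i assume "i \<in> {1..p}"
    note m[OF this, measurable]
    show "(\<lambda>s. exp (- real n * (s i)\<^sup>2)) \<in> borel_measurable (lebesgue_vec p)" by measurable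
  qed
  moreover have "{s \<in> space (lebesgue_vec p). \<forall>i\<in>{1..p}. 0 \<le> s i} \<in> sets (lebesgue_vec p)"
    using m by (intro sets.sets_Collect_finite_All borel_measurable_le) auto
  ultimately show ?thesis
    unfolding sv_weight_def[abs_def] by (intro measurable_If borel_measurable_times borel_measurable_const)
qed

definition sv_mass :: "nat \<Rightarrow> nat \<Rightarrow> (nat \<Rightarrow> real) set \<Rightarrow> ennreal" where
  "sv_mass p n A = (\<integral>\<^sup>+ s. ennreal (sv_weight p n s) * indicator A s \<partial>lebesgue_vec p)"

lemma sv_mass_mono: "A \<subseteq> B \<Longrightarrow> sv_mass p n A \<le> sv_mass p n B"
  unfolding sv_mass_def by (intro nn_integral_mono mult_left_mono) (auto split: split_indicator)

lemma sv_norm_const_eq: "sv_norm_const p n = sv_mass p n (space (lebesgue_vec p))"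
  unfolding sv_norm_const_def sv_mass_def by (intro nn_integral_cong) simp

text \<open>A normalizing constant 0 or \<open>\<infinity>\<close> would make \<open>sv_density\<close> vanish almost everywhere, which a probability
  density cannot do. So the hypothesis that the density is that of a random vector already gives
  \<open>0 < sv_norm_const p n < \<infinity>\<close>.\<close>

lemma distributed_sv_density:
  assumes "prob_space \<Omega>" and X: "distributed \<Omega> (lebesgue_vec p) X (sv_density p n)"
  shows "0 < sv_norm_const p n" "sv_norm_const p n < top"
    and "A \<in> sets (lebesgue_vec p) \<Longrightarrow> emeasure \<Omega> (X -` A \<inter> space \<Omega>) = sv_mass p n A / sv_norm_const p n"
proof -
  interpret prob_space \<Omega> by fact
  have em: "emeasure \<Omega> (X -` A \<inter> space \<Omega>) = sv_mass p n A / sv_norm_const p n"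
    if A: "A \<in> sets (lebesgue_vec p)" for A
  proof -
    have "emeasure \<Omega> (X -` A \<inter> space \<Omega>) = (\<integral>\<^sup>+ s. sv_density p n s * indicator A s \<partial>lebesgue_vec p)"
      by (rule distributed_emeasure[OF X A])
    also have "\<dots> = (\<integral>\<^sup>+ s. (ennreal (sv_weight p n s) * indicator A s) / sv_norm_const p n \<partial>lebesgue_vec p)"
      by (intro nn_integral_cong) (simp add: sv_density_def split: split_indicator)
    also have "\<dots> = sv_mass p n A / sv_norm_const p n"
      unfolding sv_mass_def using A by (intro nn_integral_divide) auto
    finally show ?thesis .
  qed
  then show "A \<in> sets (lebesgue_vec p) \<Longrightarrow> emeasure \<Omega> (X -` A \<inter> space \<Omega>) = sv_mass p n A / sv_norm_const p n" .
  have "X -` space (lebesgue_vec p) \<inter> space \<Omega> = space \<Omega>"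
    using distributed_measurable[OF X] by (auto dest: measurable_space)
  then have "sv_norm_const p n / sv_norm_const p n = 1"
    using em[OF sets.top] emeasure_space_1 by (simp add: sv_norm_const_eq)
  then show "0 < sv_norm_const p n" "sv_norm_const p n < top"
    by (cases "sv_norm_const p n = 0 \<or> sv_norm_const p n = top";
        auto simp: zero_less_iff_neq_zero less_top[symmetric])+
qed

lemma
  assumes p: "1 \<le> p" and \<Omega>: "prob_space \<Omega>"
    and X: "distributed \<Omega> (lebesgue_vec p) (\<lambda>\<omega>. \<lambda>i\<in>{1..p}. s \<omega> i) (sv_density p n)"
  shows measurable_sym_empirical_sample: "(\<lambda>\<omega>. sym_empirical p (s \<omega>)) \<in> \<Omega> \<rightarrow>\<^sub>M borel_of sym_weak_topology"
    and measure_distr_sym_empirical: "U \<in> sets (borel_of sym_weak_topology) \<Longrightarrow>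
      measure (distr \<Omega> (borel_of sym_weak_topology) (\<lambda>\<omega>. sym_empirical p (s \<omega>))) U
        = enn2real (sv_mass p n (sym_empirical p -` U \<inter> space (lebesgue_vec p)) / sv_norm_const p n)"
proof -
  let ?X = "\<lambda>\<omega>. \<lambda>i\<in>{1..p}. s \<omega> i"
  have Xm: "?X \<in> \<Omega> \<rightarrow>\<^sub>M lebesgue_vec p" using distributed_measurable[OF X] .
  have eq: "sym_empirical p (?X \<omega>) = sym_empirical p (s \<omega>)" for \<omega>
    by (rule sym_empirical_cong) simp
  show m: "(\<lambda>\<omega>. sym_empirical p (s \<omega>)) \<in> \<Omega> \<rightarrow>\<^sub>M borel_of sym_weak_topology"
    using measurable_compose[OF Xm measurable_sym_empirical[OF p]] by (simp only: eq)
  assume U: "U \<in> sets (borel_of sym_weak_topology)"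
  let ?A = "sym_empirical p -` U \<inter> space (lebesgue_vec p)"
  have A: "?A \<in> sets (lebesgue_vec p)" by (rule measurable_sets[OF measurable_sym_empirical[OF p] U])
  have "(\<lambda>\<omega>. sym_empirical p (s \<omega>)) -` U \<inter> space \<Omega> = ?X -` ?A \<inter> space \<Omega>"
    using measurable_space[OF Xm] by (auto simp: eq simp del: One_nat_def)
  then have "emeasure \<Omega> ((\<lambda>\<omega>. sym_empirical p (s \<omega>)) -` U \<inter> space \<Omega>) = sv_mass p n ?A / sv_norm_const p n"
    using distributed_sv_density(3)[OF \<Omega> X A] by simp
  then show "measure (distr \<Omega> (borel_of sym_weak_topology) (\<lambda>\<omega>. sym_empirical p (s \<omega>))) U
        = enn2real (sv_mass p n ?A / sv_norm_const p n)"
    unfolding measure_def emeasure_distr[OF m U] by simp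
qed

lemma openin_imp_sets_borel_of: "openin X U \<Longrightarrow> U \<in> sets (borel_of X)"
  unfolding borel_of_def by (subst sets_measure_of) (auto dest: openin_subset)

lemma closedin_imp_sets_borel_of:
  assumes "closedin X F" shows "F \<in> sets (borel_of X)"
proof -
  have "space (borel_of X) = topspace X"
    unfolding borel_of_def by (rule space_measure_of) (auto dest: openin_subset)
  moreover have "topspace X - (topspace X - F) = F"
    using closedin_subset[OF assms] by auto
  ultimately show ?thesis
    using sets.compl_sets[OF openin_imp_sets_borel_of[OF openin_diff[OF openin_topspace assms]]] by simp
qed

section \<open>Upper bound for the weight\<close>

lemma exp_neg_log_potential: "x \<noteq> 0 \<Longrightarrow> exp (- real k * log_potential x) = (x\<^sup>2) ^ k * exp (- real k * x\<^sup>2)"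
  by (simp add: algebra_simps exp_add exp_diff exp_minus exp_of_nat_mult field_simps)

text \<open>The factor \<open>x exp (- 2 V x) = x\<^sup>5 exp (- 2 x\<^sup>2)\<close> that is set aside for integrability, enlarged to
  \<open>x\<^sup>5 exp (- x\<^sup>2)\<close>, whose integral over \<open>[0, \<infinity>)\<close> is exactly 1.\<close>

definition tail_weight :: "real \<Rightarrow> real" where
  "tail_weight x = indicator {0..} x * (exp (- x\<^sup>2) * x ^ 5)"

lemma tail_weight_nonneg: "0 \<le> tail_weight x"
  by (simp add: tail_weight_def indicator_def)

lemma nn_integral_tail_weight: "(\<integral>\<^sup>+ x. ennreal (tail_weight x) \<partial>lborel) = 1"
proof -
  have "has_bochner_integral lborel tail_weight 1"
    using gaussian_moment_odd_pos[of 2] by (simp add: tail_weight_def[abs_def] fact_numeral)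
  then show ?thesis
    by (subst nn_integral_eq_integral) (auto simp: has_bochner_integral_iff tail_weight_nonneg)
qed

text \<open>The one-variable inequality behind this is \<open>(1 + x\<^sup>2)\<^sup>2 \<le> exp (1 + x\<^sup>2)\<close>: the \<open>p\<close>-th power of its right-hand
  side lets \<open>exp (- n x\<^sup>2)\<close> decay like \<open>exp (- (n - p) x\<^sup>2)\<close>, which matches the power \<open>x ^ (2 * (n - p))\<close>. This leaves
  \<open>exp p\<close> per variable and \<open>n - p\<close> copies of \<open>exp (- V x)\<close>, of which two go into \<open>tail_weight\<close>.\<close>

lemma sv_weight_le:
  assumes n: "p + 2 \<le> n" and nz: "\<And>i. i \<in> {1..p} \<Longrightarrow> s i \<noteq> 0"
    and V: "real p * v \<le> (\<Sum>i=1..p. log_potential (s i))"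
  shows "sv_weight p n s \<le> exp ((real p)\<^sup>2 - real (n - p - 2) * (real p * v)) * (\<Prod>i=1..p. tail_weight (s i))"
proof (cases "\<forall>i\<in>{1..p}. 0 \<le> s i")
  case False
  then have "sv_weight p n s = 0" unfolding sv_weight_def by (rule if_not_P)
  then show ?thesis by (simp add: prod_nonneg tail_weight_nonneg)
next
  case True
  have pos: "0 < s i" if "i \<in> {1..p}" for i using True nz[OF that] that by force
  have vdm: "(\<Prod>(i, j) \<in> {(i, j). 1 \<le> i \<and> i < j \<and> j \<le> p}. \<bar>(s i)\<^sup>2 - (s j)\<^sup>2\<bar>\<^sup>2)
      \<le> (\<Prod>i=1..p. ((1 + (s i)\<^sup>2)\<^sup>2) ^ p)"
  proof (rule prod_pairs_le)
    fix i j
    have "\<bar>(s i)\<^sup>2 - (s j)\<^sup>2\<bar> \<le> (1 + (s i)\<^sup>2) * (1 + (s j)\<^sup>2)"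
      by (simp add: algebra_simps abs_le_iff add_nonneg_nonneg)
    then have "\<bar>(s i)\<^sup>2 - (s j)\<^sup>2\<bar>\<^sup>2 \<le> ((1 + (s i)\<^sup>2) * (1 + (s j)\<^sup>2))\<^sup>2" by (rule power_mono) simp
    then show "0 \<le> \<bar>(s i)\<^sup>2 - (s j)\<^sup>2\<bar>\<^sup>2 \<and> \<bar>(s i)\<^sup>2 - (s j)\<^sup>2\<bar>\<^sup>2 \<le> (1 + (s i)\<^sup>2)\<^sup>2 * (1 + (s j)\<^sup>2)\<^sup>2"
      by (simp add: power_mult_distrib)
  qed (simp add: one_le_power)
  have factor: "((1 + x\<^sup>2)\<^sup>2) ^ p * (x ^ (2 * (n - p) + 1) * exp (- real n * x\<^sup>2))
      \<le> exp (real p) * exp (- real (n - p - 2) * log_potential x) * tail_weight x" if x: "0 < x" for x :: real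
  proof -
    obtain m where m: "n = p + 2 + m" using n le_Suc_ex by blast
    have p1: "0 < 1 + x\<^sup>2" by (simp add: add_pos_nonneg)
    \<comment> \<open>Rescaling by 2 before using \<open>ln t \<le> t - 1\<close> produces the coefficient 1/2 in front of \<open>x\<^sup>2\<close>.\<close>
    then have "ln (1 + x\<^sup>2) = ln ((1 + x\<^sup>2) / 2) + ln 2" by (simp add: ln_div)
    also have "\<dots> \<le> ((1 + x\<^sup>2) / 2 - 1) + (2 - 1)"
      using p1 by (intro add_mono ln_le_minus_one) auto
    finally have "2 * ln (1 + x\<^sup>2) \<le> 1 + x\<^sup>2" by (simp add: field_simps)
    then have "exp (ln (1 + x\<^sup>2) * 2) \<le> exp (1 + x\<^sup>2)" by simp
    then have "(1 + x\<^sup>2)\<^sup>2 \<le> exp (1 + x\<^sup>2)"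
      using p1 by (simp add: exp_double mult.commute)
    then have "((1 + x\<^sup>2)\<^sup>2) ^ p \<le> exp (1 + x\<^sup>2) ^ p" by (rule power_mono) simp
    also have "\<dots> = exp (real p * (1 + x\<^sup>2))" by (simp add: exp_of_nat_mult)
    finally have 1: "((1 + x\<^sup>2)\<^sup>2) ^ p \<le> exp (real p * (1 + x\<^sup>2))" .
    have "((1 + x\<^sup>2)\<^sup>2) ^ p * (x ^ (2 * (n - p) + 1) * exp (- real n * x\<^sup>2))
        \<le> exp (real p * (1 + x\<^sup>2)) * (x ^ (2 * (n - p) + 1) * exp (- real n * x\<^sup>2))"
      by (rule mult_right_mono[OF 1]) (use x in auto)
    also have "\<dots> = exp (real p) * ((x\<^sup>2) ^ m * exp (- real m * x\<^sup>2)) * (x ^ 5 * exp (- 2 * x\<^sup>2))"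
    proof -
      have "exp (real p * (1 + x\<^sup>2)) * exp (- real n * x\<^sup>2)
          = exp (real p) * exp (- real m * x\<^sup>2) * exp (- 2 * x\<^sup>2)"
        unfolding exp_add[symmetric] by (rule arg_cong[where f=exp]) (simp add: m algebra_simps)
      moreover have "x ^ (2 * (n - p) + 1) = (x\<^sup>2) ^ m * x ^ 5"
        unfolding power_mult[symmetric] power_add[symmetric] by (rule arg_cong[where f="(^) x"]) (simp add: m)
      ultimately show ?thesis by simp
    qed
    also have "\<dots> = exp (real p) * exp (- real m * log_potential x) * (x ^ 5 * exp (- 2 * x\<^sup>2))"
      using x by (subst exp_neg_log_potential) auto
    also have "\<dots> \<le> exp (real p) * exp (- real m * log_potential x) * tail_weight x"
      using x by (intro mult_left_mono) (auto simp: tail_weight_def)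
    finally show ?thesis by (simp add: m)
  qed
  have "sv_weight p n s \<le> (\<Prod>i=1..p. ((1 + (s i)\<^sup>2)\<^sup>2) ^ p) *
      (\<Prod>i = 1..p. s i ^ (2 * (n - p) + 1)) * (\<Prod>i = 1..p. exp (- real n * (s i)\<^sup>2))"
    using True vdm by (auto simp: sv_weight_def intro!: mult_right_mono prod_nonneg)
  also have "\<dots> = (\<Prod>i=1..p. ((1 + (s i)\<^sup>2)\<^sup>2) ^ p * (s i ^ (2 * (n - p) + 1) * exp (- real n * (s i)\<^sup>2)))"
    by (simp add: prod.distrib)
  also have "\<dots> \<le> (\<Prod>i=1..p. exp (real p) * exp (- real (n - p - 2) * log_potential (s i)) * tail_weight (s i))"
  proof (rule prod_mono, intro conjI)
    fix i assume i: "i \<in> {1..p}"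
    show "0 \<le> ((1 + (s i)\<^sup>2)\<^sup>2) ^ p * (s i ^ (2 * (n - p) + 1) * exp (- real n * (s i)\<^sup>2))"
      using less_imp_le[OF pos[OF i]] by (intro mult_nonneg_nonneg zero_le_power) auto
    show "((1 + (s i)\<^sup>2)\<^sup>2) ^ p * (s i ^ (2 * (n - p) + 1) * exp (- real n * (s i)\<^sup>2))
        \<le> exp (real p) * exp (- real (n - p - 2) * log_potential (s i)) * tail_weight (s i)"
      by (rule factor[OF pos[OF i]])
  qed
  also have "\<dots> = exp ((real p)\<^sup>2 - real (n - p - 2) * (\<Sum>i=1..p. log_potential (s i))) * (\<Prod>i=1..p. tail_weight (s i))"
  proof -
    have "(\<Prod>i=1..p. exp (real p) * exp (- real (n - p - 2) * log_potential (s i)))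
        = (\<Prod>i=1..p. exp (real p - real (n - p - 2) * log_potential (s i)))"
      unfolding exp_add[symmetric] by simp
    also have "\<dots> = exp (\<Sum>i=1..p. real p - real (n - p - 2) * log_potential (s i))"
      by (rule exp_sum[symmetric]) simp
    also have "(\<Sum>i=1..p. real p - real (n - p - 2) * log_potential (s i))
        = (real p)\<^sup>2 - real (n - p - 2) * (\<Sum>i=1..p. log_potential (s i))"
      by (subst sum_subtractf, subst sum_distrib_left) (simp add: power2_eq_square)
    finally show ?thesis unfolding prod.distrib by simp
  qed
  also have "\<dots> \<le> exp ((real p)\<^sup>2 - real (n - p - 2) * (real p * v)) * (\<Prod>i=1..p. tail_weight (s i))"
    using V by (intro mult_right_mono prod_nonneg) (auto simp: tail_weight_nonneg intro!: mult_left_mono)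
  finally show ?thesis .
qed

text \<open>Configurations with a vanishing coordinate, where the potential is infinite, have weight 0. On all
  others the pointwise bound is a product, and it integrates to 1 in each coordinate.\<close>

lemma sv_mass_le:
  assumes n: "p + 2 \<le> n" and A: "A \<in> sets (lebesgue_vec p)"
    and V: "\<And>s. s \<in> A \<Longrightarrow> (\<And>i. i \<in> {1..p} \<Longrightarrow> s i \<noteq> 0) \<Longrightarrow> real p * v \<le> (\<Sum>i=1..p. log_potential (s i))"
  shows "sv_mass p n A \<le> ennreal (exp ((real p)\<^sup>2 - real (n - p - 2) * (real p * v)))"
proof -
  interpret product_sigma_finite "\<lambda>_::nat. lborel :: real measure" ..
  let ?K = "exp ((real p)\<^sup>2 - real (n - p - 2) * (real p * v))"
  have "sv_mass p n A \<le> (\<integral>\<^sup>+ s. ennreal ?K * (\<Prod>i\<in>{1..p}. ennreal (tail_weight (s i))) \<partial>(\<Pi>\<^sub>M i\<in>{1..p}. lborel))"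
    unfolding sv_mass_def lebesgue_vec_def[symmetric]
  proof (rule nn_integral_mono)
    fix s :: "nat \<Rightarrow> real"
    show "ennreal (sv_weight p n s) * indicator A s \<le> ennreal ?K * (\<Prod>i\<in>{1..p}. ennreal (tail_weight (s i)))"
    proof (cases "s \<in> A \<and> (\<forall>i\<in>{1..p}. s i \<noteq> 0)")
      case True
      then have "sv_weight p n s \<le> ?K * (\<Prod>i=1..p. tail_weight (s i))"
        using V by (intro sv_weight_le n) auto
      then have "ennreal (sv_weight p n s) \<le> ennreal (?K * (\<Prod>i=1..p. tail_weight (s i)))"
        by (rule ennreal_leI)
      then show ?thesis using True by (simp add: ennreal_mult prod_nonneg tail_weight_nonneg prod_ennreal)
    next
      case False
      have "sv_weight p n s = 0" if "\<not> (\<forall>i\<in>{1..p}. s i \<noteq> 0)"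
      proof -
        have "(\<Prod>i = 1..p. s i ^ (2 * (n - p) + 1)) = 0" using that by (auto intro!: prod_zero)
        then show ?thesis by (simp add: sv_weight_def)
      qed
      then show ?thesis using False by (auto split: split_indicator)
    qed
  qed
  also have "\<dots> = ennreal ?K * (\<Prod>i\<in>{1..p}. \<integral>\<^sup>+ x. ennreal (tail_weight x) \<partial>lborel)"
    by (subst nn_integral_cmult, simp_all add: tail_weight_def, subst product_nn_integral_prod)
       (auto simp: tail_weight_def)
  also have "\<dots> = ennreal ?K" by (simp add: nn_integral_tail_weight)
  finally show ?thesis .
qed

section \<open>Lower bound for the weight of a small box\<close>

text \<open>Moving a point upwards by at most \<open>2 \<delta>\<close> can only increase \<open>ln x\<close> and changes \<open>x\<^sup>2\<close> by at most
  \<open>\<delta> (2 y\<^sup>2 + 6)\<close>. Replacing the power \<open>2 (n - p) + 1\<close> by \<open>2 n\<close> costs \<open>(2 p - 1) ln x\<close>, which is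
  at most \<open>p x\<^sup>2\<close>.\<close>

lemma weight_factor_ge:
  fixes x y \<delta> :: real
  assumes p: "1 \<le> p" "p \<le> n" and \<delta>: "0 < \<delta>" "\<delta> \<le> 1" and y: "0 < y" and x: "y \<le> x" "x \<le> y + 2 * \<delta>"
  shows "exp (- (real n * log_potential y) - real n * \<delta> * (2 * y\<^sup>2 + 6) - real p * (3 * y\<^sup>2 + 6))
    \<le> x ^ (2 * (n - p) + 1) * exp (- real n * x\<^sup>2)"
proof -
  have x0: "0 < x" using x y by simp
  have lnx: "2 * ln x \<le> x\<^sup>2" using ln_le_minus_one[of "x\<^sup>2"] x0 by (simp add: ln_realpow)
  have "x\<^sup>2 \<le> (y + 2 * \<delta>)\<^sup>2" using x x0 by (intro power_mono) auto
  also have "\<dots> = y\<^sup>2 + 2 * \<delta> * (2 * y) + 4 * \<delta> * \<delta>" by (simp add: power2_eq_square algebra_simps)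
  also have "\<dots> \<le> y\<^sup>2 + 2 * \<delta> * (y\<^sup>2 + 1) + 4 * \<delta> * 1"
  proof -
    have "2 * y \<le> y\<^sup>2 + 1" using zero_le_power2[of "y - 1"] by (simp add: power2_eq_square algebra_simps)
    then show ?thesis using \<delta> by (intro add_mono mult_left_mono) auto
  qed
  finally have sq: "x\<^sup>2 \<le> y\<^sup>2 + \<delta> * (2 * y\<^sup>2 + 6)" by (simp add: algebra_simps)
  also have "\<dots> \<le> y\<^sup>2 + 1 * (2 * y\<^sup>2 + 6)" using \<delta> by (intro add_left_mono mult_right_mono) auto
  finally have sq3: "x\<^sup>2 \<le> 3 * y\<^sup>2 + 6" by simp
  have "(2 * real p - 1) * (2 * ln x) \<le> (2 * real p - 1) * x\<^sup>2"
    using p lnx by (intro mult_left_mono) auto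
  also have "\<dots> \<le> 2 * real p * x\<^sup>2" by (simp add: algebra_simps)
  also have "\<dots> \<le> 2 * real p * (3 * y\<^sup>2 + 6)" using sq3 by (intro mult_left_mono) auto
  finally have 1: "(2 * real p - 1) * ln x \<le> real p * (3 * y\<^sup>2 + 6)" by simp
  have 2: "real n * x\<^sup>2 \<le> real n * y\<^sup>2 + real n * \<delta> * (2 * y\<^sup>2 + 6)"
    using mult_left_mono[OF sq, of "real n"] by (simp add: algebra_simps)
  have 3: "real n * (2 * ln y) \<le> real n * (2 * ln x)"
    using x y by (intro mult_left_mono) auto
  have "- (real n * log_potential y) - real n * \<delta> * (2 * y\<^sup>2 + 6) - real p * (3 * y\<^sup>2 + 6)
      \<le> real n * (2 * ln x) - (2 * real p - 1) * ln x - real n * x\<^sup>2"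
    using 1 2 3 y by (simp add: ln_realpow right_diff_distrib)
  also have "\<dots> = real (2 * (n - p) + 1) * ln x - real n * x\<^sup>2"
    using p by (simp add: of_nat_diff algebra_simps)
  finally have "exp (- (real n * log_potential y) - real n * \<delta> * (2 * y\<^sup>2 + 6) - real p * (3 * y\<^sup>2 + 6))
     \<le> exp (real (2 * (n - p) + 1) * ln x - real n * x\<^sup>2)" by simp
  also have "\<dots> = exp (real (2 * (n - p) + 1) * ln x) * exp (- real n * x\<^sup>2)"
    unfolding exp_add[symmetric] by simp
  also have "exp (real (2 * (n - p) + 1) * ln x) = x ^ (2 * (n - p) + 1)"
    unfolding exp_of_nat_mult using x0 by simp
  finally show ?thesis .
qed

text \<open>The shift \<open>\<delta> i / p\<close> separates points that may coincide in \<open>y\<close>. The side length is half the shift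
  between neighbours, so that at least half of each gap survives.\<close>

definition spread_box :: "nat \<Rightarrow> real \<Rightarrow> (nat \<Rightarrow> real) \<Rightarrow> (nat \<Rightarrow> real) set" where
  "spread_box p \<delta> y = (\<Pi>\<^sub>E i\<in>{1..p}. {y i + \<delta> * real i / real p .. y i + \<delta> * real i / real p + \<delta> / (2 * real p)})"

lemma spread_box_close:
  assumes p: "1 \<le> p" and \<delta>: "0 < \<delta>" and s: "s \<in> spread_box p \<delta> y" and i: "i \<in> {1..p}"
  shows "y i \<le> s i" "s i \<le> y i + 2 * \<delta>"
proof -
  have b: "y i + \<delta> * real i / real p \<le> s i" "s i \<le> y i + \<delta> * real i / real p + \<delta> / (2 * real p)"
    using s i by (auto simp: spread_box_def PiE_iff)
  have "\<delta> * real i / real p \<le> \<delta>" "\<delta> / (2 * real p) \<le> \<delta>" "0 \<le> \<delta> * real i / real p"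
    using p \<delta> i by (auto simp: divide_le_eq)
  with b show "y i \<le> s i" "s i \<le> y i + 2 * \<delta>" by linarith+
qed

text \<open>For nonnegative increasing points \<open>s\<^sub>j\<^sup>2 - s\<^sub>i\<^sup>2 \<ge> (s\<^sub>j - s\<^sub>i)\<^sup>2\<close>, so the Vandermonde factor is at least the
  fourth power of the product of the gaps. The second moment needed for the sum of the one-variable
  estimates is at most \<open>2 p G\<close>, because \<open>y\<^sup>2 / 2 \<le> V y\<close>.\<close>

lemma sv_weight_spread_box_ge:
  assumes p: "1 \<le> p" "p \<le> n" and \<delta>: "0 < \<delta>" "\<delta> \<le> 1" and y: "\<And>i. i \<in> {1..p} \<Longrightarrow> 0 < y i"
    and mono: "\<And>i j. 1 \<le> i \<Longrightarrow> i < j \<Longrightarrow> j \<le> p \<Longrightarrow> y i \<le> y j"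
    and V: "(\<Sum>i=1..p. log_potential (y i)) \<le> real p * G" and s: "s \<in> spread_box p \<delta> y"
  shows "exp (- (real p * real n * (G + \<delta> * (4 * G + 6))) - (real p)\<^sup>2 * (6 * G + 10 + 4 * ln (2 / \<delta>)))
    \<le> sv_weight p n s"
proof -
  note close = spread_box_close[OF p(1) \<delta>(1) s]
  have pos: "0 < s i" if "i \<in> {1..p}" for i using y[OF that] close(1)[OF that] by simp
  have gap: "\<delta> / 2 * (real j - real i) / real p \<le> s j - s i" if ij: "1 \<le> i" "i < j" "j \<le> p" for i j
  proof -
    have b: "y j + \<delta> * real j / real p \<le> s j" "s i \<le> y i + \<delta> * real i / real p + \<delta> / (2 * real p)"
      using s ij by (auto simp: spread_box_def PiE_iff)
    have "\<delta> / 2 * 1 / real p \<le> \<delta> / 2 * (real j - real i) / real p"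
      using ij \<delta> by (intro divide_right_mono mult_left_mono) auto
    then have "\<delta> / (2 * real p) \<le> \<delta> / 2 * (real j - real i) / real p" by simp
    moreover have "\<delta> * real j / real p - \<delta> * real i / real p = 2 * (\<delta> / 2 * (real j - real i) / real p)"
      by (simp add: diff_divide_distrib right_diff_distrib)
    ultimately show ?thesis using b mono[OF ij] by linarith
  qed
  let ?L = "{(i, j). 1 \<le> i \<and> i < j \<and> j \<le> p}"
  let ?\<kappa> = "\<delta> / 2"
  have "?\<kappa> ^ p * exp (- real p) = exp (- (real p * (1 + ln (2 / \<delta>))))"
  proof -
    have "?\<kappa> = exp (- ln (2 / \<delta>))" using \<delta> by (simp add: exp_minus)
    then have "?\<kappa> ^ p = exp (- ln (2 / \<delta>)) ^ p" by (rule arg_cong)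
    also have "\<dots> = exp (real p * (- ln (2 / \<delta>)))" by (rule exp_of_nat_mult[symmetric])
    finally have "?\<kappa> ^ p = exp (real p * (- ln (2 / \<delta>)))" .
    then show ?thesis by (simp add: exp_add[symmetric] algebra_simps)
  qed
  then have "exp (- ((real p)\<^sup>2 * (4 + 4 * ln (2 / \<delta>)))) = ((?\<kappa> ^ p * exp (- real p)) ^ p) ^ 4"
    by (simp add: exp_of_nat_mult[symmetric] power2_eq_square algebra_simps)
  also have "\<dots> \<le> (\<Prod>(i, j)\<in>?L. s j - s i) ^ 4"
    by (intro power_mono prod_pairs_ge[OF gap]) (use \<delta> in auto)
  also have "\<dots> = (\<Prod>(i, j)\<in>?L. (s j - s i) ^ 4)"
    by (simp add: prod_power_distrib case_prod_beta)
  also have "\<dots> \<le> (\<Prod>(i, j)\<in>?L. \<bar>(s i)\<^sup>2 - (s j)\<^sup>2\<bar>\<^sup>2)"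
  proof (rule prod_mono, clarify)
    fix i j assume ij: "1 \<le> i" "i < j" "j \<le> p"
    have lt: "s i \<le> s j" using gap[OF ij] ij \<delta> by (smt (verit) divide_nonneg_nonneg mult_nonneg_nonneg of_nat_mono of_nat_0_le_iff less_imp_le)
    have "(s j - s i) * (s j - s i) \<le> (s j - s i) * (s j + s i)"
      using lt pos[of i] ij by (intro mult_left_mono) auto
    also have "\<dots> = (s j)\<^sup>2 - (s i)\<^sup>2" by (simp add: power2_eq_square algebra_simps)
    finally have le: "((s j - s i)\<^sup>2)\<^sup>2 \<le> ((s j)\<^sup>2 - (s i)\<^sup>2)\<^sup>2" by (intro power_mono) (auto simp: power2_eq_square)
    have 4: "(s j - s i) ^ 4 = ((s j - s i)\<^sup>2)\<^sup>2" by (simp flip: power_mult)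
    have 2: "\<bar>(s i)\<^sup>2 - (s j)\<^sup>2\<bar>\<^sup>2 = ((s j)\<^sup>2 - (s i)\<^sup>2)\<^sup>2"
      by (subst power2_abs) (rule power2_commute)
    show "0 \<le> (s j - s i) ^ 4 \<and> (s j - s i) ^ 4 \<le> \<bar>(s i)\<^sup>2 - (s j)\<^sup>2\<bar>\<^sup>2"
      unfolding 4 2 by (rule conjI[OF zero_le_power2 le])
  qed
  finally have vdm: "exp (- ((real p)\<^sup>2 * (4 + 4 * ln (2 / \<delta>)))) \<le> (\<Prod>(i, j)\<in>?L. \<bar>(s i)\<^sup>2 - (s j)\<^sup>2\<bar>\<^sup>2)" .
  have "(\<Sum>i=1..p. (y i)\<^sup>2) \<le> (\<Sum>i=1..p. 2 * log_potential (y i))"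
  proof (rule sum_mono)
    fix i assume "i \<in> {1..p}"
    from log_potential_ge_half_sq[of "y i"] y[OF this] show "(y i)\<^sup>2 \<le> 2 * log_potential (y i)" by simp
  qed
  also have "\<dots> \<le> 2 * (real p * G)" using V unfolding sum_distrib_left[symmetric] by simp
  finally have Y: "(\<Sum>i=1..p. (y i)\<^sup>2) \<le> 2 * (real p * G)" .
  have Yn: "real n * \<delta> * (\<Sum>i=1..p. (y i)\<^sup>2) \<le> real n * \<delta> * (2 * (real p * G))"
    using Y \<delta> by (intro mult_left_mono) auto
  have Yp: "real p * (\<Sum>i=1..p. (y i)\<^sup>2) \<le> real p * (2 * (real p * G))"
    using Y by (intro mult_left_mono) auto
  have Vn: "real n * (\<Sum>i=1..p. log_potential (y i)) \<le> real n * (real p * G)"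
    using V by (intro mult_left_mono) auto
  have "- (real p * real n * (G + \<delta> * (4 * G + 6))) - (real p)\<^sup>2 * (6 * G + 6)
      \<le> - (real n * (\<Sum>i=1..p. log_potential (y i))) - real n * \<delta> * (2 * (\<Sum>i=1..p. (y i)\<^sup>2) + 6 * real p)
         - real p * (3 * (\<Sum>i=1..p. (y i)\<^sup>2) + 6 * real p)"
    using Yn Yp Vn by (simp add: algebra_simps power2_eq_square)
  also have "\<dots> = (\<Sum>i=1..p. - (real n * log_potential (y i)) - real n * \<delta> * (2 * (y i)\<^sup>2 + 6) - real p * (3 * (y i)\<^sup>2 + 6))"
    by (simp add: sum_subtractf sum.distrib sum_negf algebra_simps flip: sum_distrib_left)
  finally have "exp (- (real p * real n * (G + \<delta> * (4 * G + 6))) - (real p)\<^sup>2 * (6 * G + 6))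
      \<le> (\<Prod>i=1..p. exp (- (real n * log_potential (y i)) - real n * \<delta> * (2 * (y i)\<^sup>2 + 6) - real p * (3 * (y i)\<^sup>2 + 6)))"
    by (simp add: exp_sum[symmetric])
  also have "\<dots> \<le> (\<Prod>i=1..p. s i ^ (2 * (n - p) + 1) * exp (- real n * (s i)\<^sup>2))"
    by (intro prod_mono conjI weight_factor_ge p \<delta> y close) auto
  finally have fac: "exp (- (real p * real n * (G + \<delta> * (4 * G + 6))) - (real p)\<^sup>2 * (6 * G + 6))
    \<le> (\<Prod>i=1..p. s i ^ (2 * (n - p) + 1) * exp (- real n * (s i)\<^sup>2))" .
  have "exp (- (real p * real n * (G + \<delta> * (4 * G + 6))) - (real p)\<^sup>2 * (6 * G + 10 + 4 * ln (2 / \<delta>)))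
     = exp (- ((real p)\<^sup>2 * (4 + 4 * ln (2 / \<delta>))))
      * exp (- (real p * real n * (G + \<delta> * (4 * G + 6))) - (real p)\<^sup>2 * (6 * G + 6))"
    unfolding exp_add[symmetric] by (rule arg_cong[where f=exp]) (simp add: algebra_simps)
  also have "\<dots> \<le> (\<Prod>(i, j)\<in>?L. \<bar>(s i)\<^sup>2 - (s j)\<^sup>2\<bar>\<^sup>2)
      * (\<Prod>i=1..p. s i ^ (2 * (n - p) + 1) * exp (- real n * (s i)\<^sup>2))"
    by (rule mult_mono[OF vdm fac]) (auto intro!: prod_nonneg)
  also have "\<dots> = sv_weight p n s"
    using pos unfolding sv_weight_def prod.distrib by (subst if_P) (auto intro: less_imp_le)
  finally show ?thesis .
qed

lemma sets_spread_box: "spread_box p \<delta> y \<in> sets (lebesgue_vec p)"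
  unfolding spread_box_def lebesgue_vec_def by (intro sets_PiM_I_finite) auto

lemma sv_mass_spread_box_ge:
  assumes p: "1 \<le> p" "p \<le> n" and \<delta>: "0 < \<delta>" "\<delta> \<le> 1" and y: "\<And>i. i \<in> {1..p} \<Longrightarrow> 0 < y i"
    and mono: "\<And>i j. 1 \<le> i \<Longrightarrow> i < j \<Longrightarrow> j \<le> p \<Longrightarrow> y i \<le> y j"
    and V: "(\<Sum>i=1..p. log_potential (y i)) \<le> real p * G"
  shows "ennreal (exp (- (real p * real n * (G + \<delta> * (4 * G + 6))) - (real p)\<^sup>2 * (6 * G + 10 + 4 * ln (2 / \<delta>))
      - real p * ln (2 * real p / \<delta>))) \<le> sv_mass p n (spread_box p \<delta> y)"
proof -
  interpret product_sigma_finite "\<lambda>_::nat. lborel :: real measure" ..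
  let ?K = "exp (- (real p * real n * (G + \<delta> * (4 * G + 6))) - (real p)\<^sup>2 * (6 * G + 10 + 4 * ln (2 / \<delta>)))"
  have "emeasure (lebesgue_vec p) (spread_box p \<delta> y) = (\<Prod>i\<in>{1..p}. ennreal (\<delta> / (2 * real p)))"
    unfolding spread_box_def lebesgue_vec_def using \<delta> p by (subst emeasure_PiM) auto
  also have "\<dots> = ennreal ((\<delta> / (2 * real p)) ^ p)" using \<delta> by (simp add: ennreal_power)
  also have "(\<delta> / (2 * real p)) ^ p = exp (- (real p * ln (2 * real p / \<delta>)))"
  proof -
    have "\<delta> / (2 * real p) = exp (- ln (2 * real p / \<delta>))" using \<delta> p by (simp add: exp_minus)
    then show ?thesis by (simp add: exp_of_nat_mult[symmetric])
  qed
  finally have vol: "emeasure (lebesgue_vec p) (spread_box p \<delta> y) = ennreal (exp (- (real p * ln (2 * real p / \<delta>))))" .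
  have "ennreal (exp (- (real p * real n * (G + \<delta> * (4 * G + 6))) - (real p)\<^sup>2 * (6 * G + 10 + 4 * ln (2 / \<delta>))
      - real p * ln (2 * real p / \<delta>))) = ennreal ?K * emeasure (lebesgue_vec p) (spread_box p \<delta> y)"
    unfolding vol by (subst ennreal_mult[symmetric]) (simp_all flip: exp_add)
  also have "\<dots> = (\<integral>\<^sup>+ s. ennreal ?K * indicator (spread_box p \<delta> y) s \<partial>lebesgue_vec p)"
    using sets_spread_box by (subst nn_integral_cmult_indicator) auto
  also have "\<dots> \<le> sv_mass p n (spread_box p \<delta> y)"
    unfolding sv_mass_def
    using sv_weight_spread_box_ge[OF p \<delta> y mono V]
    by (intro nn_integral_mono) (auto split: split_indicator intro!: ennreal_leI)
  finally show ?thesis .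
qed

section \<open>Points with a prescribed empirical measure\<close>

text \<open>One point in each cell of a regular grid approximates the uniform distribution function up to
  \<open>1 / p\<close>, wherever in its cell the point lies.\<close>

lemma card_grid_bounds:
  fixes t :: "nat \<Rightarrow> real" and C :: real
  assumes p: "1 \<le> p" and t: "\<And>i. i \<in> {1..p} \<Longrightarrow> real (i - 1) / real p < t i \<and> t i < real i / real p"
    and C: "0 \<le> C" "C \<le> 1"
  shows "\<bar>real (card {i \<in> {1..p}. t i \<le> C}) / real p - C\<bar> \<le> 1 / real p"
proof -
  \<comment> \<open>Cells entirely below \<open>C\<close> contribute, and only cells that start below \<open>C\<close> can contribute.\<close>
  have "{1..nat \<lfloor>C * real p\<rfloor>} \<subseteq> {i \<in> {1..p}. t i \<le> C}"
  proof
    fix i assume i: "i \<in> {1..nat \<lfloor>C * real p\<rfloor>}"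
    then have "int i \<le> \<lfloor>C * real p\<rfloor>" by auto
    then have a: "real i \<le> C * real p" by (simp add: le_floor_iff)
    have "C * real p \<le> 1 * real p" using C by (intro mult_right_mono) auto
    with a have "real i \<le> real p" by linarith
    moreover have "real i / real p \<le> C" using a p by (simp add: divide_le_eq)
    ultimately have "real i \<le> real p" "real i / real p \<le> C" by auto
    then have "i \<in> {1..p}" "real i / real p \<le> C" using i by auto
    with t[of i] show "i \<in> {i \<in> {1..p}. t i \<le> C}" by auto
  qed
  then have "card {1..nat \<lfloor>C * real p\<rfloor>} \<le> card {i \<in> {1..p}. t i \<le> C}" by (intro card_mono) auto
  then have "real (nat \<lfloor>C * real p\<rfloor>) \<le> real (card {i \<in> {1..p}. t i \<le> C})" by simp
  moreover have "C * real p - 1 \<le> real (nat \<lfloor>C * real p\<rfloor>)" using C by (simp add: of_nat_nat)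
  ultimately have low: "C * real p - 1 \<le> real (card {i \<in> {1..p}. t i \<le> C})" by linarith
  have "{i \<in> {1..p}. t i \<le> C} \<subseteq> {1..nat \<lceil>C * real p\<rceil>}"
  proof
    fix i assume "i \<in> {i \<in> {1..p}. t i \<le> C}"
    then have i: "i \<in> {1..p}" "t i \<le> C" by auto
    with t[of i] have "real (i - 1) / real p < C" by auto
    then have "real (i - 1) < C * real p" using p by (simp add: divide_less_eq)
    then have "real i - 1 < C * real p" using i by (simp add: of_nat_diff)
    then have "real i - 1 < of_int \<lceil>C * real p\<rceil>" using le_of_int_ceiling[of "C * real p"] by linarith
    then have "int i \<le> \<lceil>C * real p\<rceil>" by linarith
    with i show "i \<in> {1..nat \<lceil>C * real p\<rceil>}" by auto
  qed
  then have "card {i \<in> {1..p}. t i \<le> C} \<le> card {1..nat \<lceil>C * real p\<rceil>}" by (intro card_mono) auto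
  then have "real (card {i \<in> {1..p}. t i \<le> C}) \<le> real (nat \<lceil>C * real p\<rceil>)" by simp
  moreover have "real (nat \<lceil>C * real p\<rceil>) \<le> C * real p + 1" using C by (simp add: of_nat_nat)
  ultimately have "real (card {i \<in> {1..p}. t i \<le> C}) \<le> C * real p + 1" by linarith
  with low have "\<bar>real (card {i \<in> {1..p}. t i \<le> C}) - C * real p\<bar> \<le> 1" by linarith
  then have "\<bar>real (card {i \<in> {1..p}. t i \<le> C}) - C * real p\<bar> / real p \<le> 1 / real p"
    by (intro divide_right_mono) auto
  moreover have "\<bar>N - C * real p\<bar> / real p = \<bar>N / real p - C\<bar>" for N
  proof -
    have "N / real p - C = (N - C * real p) / real p" using p by (simp add: field_simps)
    then show ?thesis by (simp add: abs_divide)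
  qed
  ultimately show ?thesis by simp
qed

text \<open>The freedom in choosing the point of each bin is used for the potential: a function somewhere does not
  exceed its mean. The weak limit is insensitive to this choice, because the empirical distribution
  function of quantiles is off by at most \<open>1 / p\<close>. As the potential is infinite at 0, the chosen
  quantiles are nonzero. The slack \<open>\<epsilon>\<close> replaces a discussion of whether the mean is attained.\<close>

lemma quantile_points:
  assumes \<mu>: "\<mu> \<in> sym_prob_measures" and G: "(\<integral>\<^sup>+ x. potential x \<partial>\<mu>) \<le> ennreal G" and \<epsilon>: "0 < \<epsilon>"
  obtains y :: "nat \<Rightarrow> nat \<Rightarrow> real"
  where "\<And>p i. 1 \<le> p \<Longrightarrow> i \<in> {1..p} \<Longrightarrow> 0 < y p i"
    and "\<And>p i j. 1 \<le> i \<Longrightarrow> i < j \<Longrightarrow> j \<le> p \<Longrightarrow> y p i \<le> y p j"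
    and "\<And>p. 1 \<le> p \<Longrightarrow> (\<Sum>i=1..p. log_potential (y p i)) \<le> real p * (G + \<epsilon>)"
    and "(\<lambda>p. d_BL (sym_empirical p (y p)) \<mu>) \<longlonglongrightarrow> 0"
proof -
  interpret \<mu>: real_distribution \<mu> using \<mu> by (simp add: sym_prob_measures_iff)
  define \<nu> where "\<nu> = distr \<mu> borel abs"
  have "real_distribution \<nu>"
    unfolding \<nu>_def by (auto simp: real_distribution_def real_distribution_axioms_def intro: \<mu>.prob_space_distr)
  then interpret \<nu>: cdf_distribution \<nu> by (simp add: cdf_distribution_def)
  let ?U = "restrict_space lborel {0<..<1::real}"
  have Q_nonneg: "0 \<le> \<nu>.I t" if t: "t \<in> {0<..<1}" for t
  proof (rule ccontr)
    \<comment> \<open>A negative quantile would mean positive mass of \<open>\<bar>x\<bar>\<close> on the negative half-line.\<close>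
    assume "\<not> 0 \<le> \<nu>.I t"
    then have neg: "\<nu>.I t < 0" by simp
    have "t \<le> cdf \<nu> (\<nu>.I t)" using \<nu>.pseudoinverse[of t "\<nu>.I t"] t by simp
    also have "cdf \<nu> (\<nu>.I t) = measure \<mu> (abs -` {..\<nu>.I t} \<inter> space \<mu>)"
      unfolding cdf_def \<nu>_def by (subst measure_distr) auto
    also have "abs -` {..\<nu>.I t} = {}" using neg by (auto simp: vimage_def)
    finally show False using t by simp
  qed
  have "sets ?U = sets (restrict_space borel {0<..<1})" by (rule sets_restrict_space_cong) simp
  then have Qm: "\<nu>.I \<in> borel_measurable ?U"
    using \<nu>.measurable_CI measurable_cong_sets by blast
  have pQ [measurable]: "(\<lambda>t. potential (\<nu>.I t)) \<in> borel_measurable ?U"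
    by (rule measurable_compose[OF Qm measurable_potential])
  have int_le: "(\<integral>\<^sup>+ t. potential (\<nu>.I t) \<partial>?U) \<le> ennreal G"
  proof -
    have "(\<integral>\<^sup>+ t. potential (\<nu>.I t) \<partial>?U) = (\<integral>\<^sup>+ x. potential x \<partial>distr ?U borel \<nu>.I)"
      by (rule nn_integral_distr[symmetric, OF Qm]) simp
    also have "\<dots> = (\<integral>\<^sup>+ x. potential x \<partial>\<nu>)" by (simp only: \<nu>.distr_I_eq_M)
    also have "\<dots> = (\<integral>\<^sup>+ x. potential \<bar>x\<bar> \<partial>\<mu>)" unfolding \<nu>_def by (subst nn_integral_distr) auto
    also have "\<dots> = (\<integral>\<^sup>+ x. potential x \<partial>\<mu>)" by (intro nn_integral_cong) (simp add: abs_if)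
    finally show ?thesis using G by simp
  qed
  define bin where "bin p i = {real (i - 1) / real p <..< real i / real p}" for p i :: nat
  define c where "c p i = (\<integral>\<^sup>+ t. potential (\<nu>.I t) * indicator (bin p i) t \<partial>?U)" for p i
  have bin_sub: "bin p i \<subseteq> {0<..<1}" if "1 \<le> p" "i \<in> {1..p}" for p i
  proof
    fix t assume "t \<in> bin p i"
    then have "real (i - 1) / real p < t" "t < real i / real p" by (auto simp: bin_def)
    moreover have "0 \<le> real (i - 1) / real p" "real i / real p \<le> 1" using that by auto
    ultimately show "t \<in> {0<..<1}" unfolding greaterThanLessThan_iff by linarith
  qed
  have bin_sets [measurable]: "bin p i \<in> sets ?U" if "1 \<le> p" "i \<in> {1..p}" for p i
    using bin_sub[OF that] by (auto simp: sets_restrict_space_iff bin_def)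
  have bin_meas: "emeasure ?U (bin p i) = ennreal (1 / real p)" if "1 \<le> p" "i \<in> {1..p}" for p i
  proof -
    have "emeasure ?U (bin p i) = emeasure lborel (bin p i)"
      using bin_sub[OF that] by (subst emeasure_restrict_space) auto
    also have "\<dots> = ennreal (real i / real p - real (i - 1) / real p)"
      unfolding bin_def using that by (subst emeasure_lborel_Ioo) (auto intro: divide_right_mono)
    also have "real i / real p - real (i - 1) / real p = 1 / real p"
      using that by (simp add: of_nat_diff diff_divide_distrib)
    finally show ?thesis .
  qed
  have bin_lt: "t < t'" if "t \<in> bin p i" "t' \<in> bin p j" "1 \<le> i" "i < j" for t t' p i j
  proof -
    have "t < real i / real p" using that by (simp add: bin_def)
    also have "\<dots> \<le> real (j - 1) / real p" using that by (intro divide_right_mono) auto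
    also have "\<dots> < t'" using that by (simp add: bin_def)
    finally show ?thesis .
  qed
  have sum_c: "(\<Sum>i=1..p. c p i) \<le> ennreal G" if p: "1 \<le> p" for p
  proof -
    have "(\<Sum>i=1..p. c p i) = (\<integral>\<^sup>+ t. (\<Sum>i=1..p. potential (\<nu>.I t) * indicator (bin p i) t) \<partial>?U)"
      unfolding c_def using p by (intro nn_integral_sum[symmetric]) auto
    also have "\<dots> = (\<integral>\<^sup>+ t. potential (\<nu>.I t) * indicator (\<Union>i\<in>{1..p}. bin p i) t \<partial>?U)"
    proof (intro nn_integral_cong)
      fix t
      have "disjoint_family_on (bin p) {1..p}"
        unfolding disjoint_family_on_def using bin_lt[of _ p] by (metis atLeastAtMost_iff disjoint_iff less_irrefl nat_neq_iff)
      then have "(\<Sum>i=1..p. indicator (bin p i) t) = (indicator (\<Union>i\<in>{1..p}. bin p i) t :: ennreal)"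
        by (intro indicator_UN_disjoint[symmetric]) auto
      then show "(\<Sum>i=1..p. potential (\<nu>.I t) * indicator (bin p i) t)
          = potential (\<nu>.I t) * indicator (\<Union>i\<in>{1..p}. bin p i) t"
        by (simp only: sum_distrib_left[symmetric])
    qed
    also have "\<dots> \<le> (\<integral>\<^sup>+ t. potential (\<nu>.I t) \<partial>?U)"
      by (intro nn_integral_mono) (auto split: split_indicator)
    also note int_le
    finally show ?thesis .
  qed
  have c_fin: "c p i < top" if "1 \<le> p" "i \<in> {1..p}" for p i
  proof -
    have "c p i \<le> (\<Sum>i=1..p. c p i)" using that by (intro member_le_sum) auto
    also have "\<dots> \<le> ennreal G" using sum_c that by simp
    also have "\<dots> < top" by simp
    finally show ?thesis .
  qed
  have "\<exists>t\<in>bin p i. potential (\<nu>.I t) \<le> ennreal (real p * enn2real (c p i) + \<epsilon>)"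
    if pi: "1 \<le> p" "i \<in> {1..p}" for p i
  proof (rule ccontr)
    assume "\<not> ?thesis"
    then have *: "ennreal (real p * enn2real (c p i) + \<epsilon>) \<le> potential (\<nu>.I t)" if "t \<in> bin p i" for t
      using that by (auto simp: not_le intro: less_imp_le)
    define K where "K = real p * enn2real (c p i) + \<epsilon>"
    note * = *[folded K_def]
    have K: "0 \<le> K" using \<epsilon> by (simp add: K_def)
    have "ennreal K * ennreal (1 / real p)
        = (\<integral>\<^sup>+ t. ennreal K * indicator (bin p i) t \<partial>?U)"
      unfolding bin_meas[OF pi, symmetric] using pi by (subst nn_integral_cmult_indicator) auto
    also have "\<dots> \<le> c p i"
      unfolding c_def using * by (intro nn_integral_mono) (auto split: split_indicator simp: c_def)
    also have "\<dots> = ennreal (enn2real (c p i))" using c_fin[OF pi] by simp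
    finally have "ennreal (K * (1 / real p)) \<le> ennreal (enn2real (c p i))"
      using K by (subst ennreal_mult) auto
    then have "K * (1 / real p) \<le> enn2real (c p i)" by (subst (asm) ennreal_le_iff) auto
    then show False using pi \<epsilon> by (simp add: field_simps K_def)
  qed
  then obtain t where t: "\<And>p i. 1 \<le> p \<Longrightarrow> i \<in> {1..p} \<Longrightarrow> t p i \<in> bin p i"
    and Vt: "\<And>p i. 1 \<le> p \<Longrightarrow> i \<in> {1..p} \<Longrightarrow>
        potential (\<nu>.I (t p i)) \<le> ennreal (real p * enn2real (c p i) + \<epsilon>)"
    by metis
  define y where "y p i = \<nu>.I (t p i)" for p i
  have t01: "t p i \<in> {0<..<1}" if "1 \<le> p" "i \<in> {1..p}" for p i
    using t[OF that] bin_sub[OF that] by blast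
  have ypos: "0 < y p i" if "1 \<le> p" "i \<in> {1..p}" for p i
  proof -
    have "y p i \<noteq> 0" using Vt[OF that] by (auto simp: y_def top_unique)
    moreover have "0 \<le> y p i" using Q_nonneg[OF t01[OF that]] by (simp add: y_def)
    ultimately show ?thesis by simp
  qed
  have ymono: "y p i \<le> y p j" if ij: "1 \<le> i" "i < j" "j \<le> p" for p i j
  proof -
    have "t p i < t p j" using ij by (intro bin_lt[of _ p i _ j] t) auto
    then show ?thesis
      unfolding y_def using ij by (intro mono_onD[OF \<nu>.mono_I] t01) auto
  qed
  have ysum: "(\<Sum>i=1..p. log_potential (y p i)) \<le> real p * (G + \<epsilon>)" if p: "1 \<le> p" for p
  proof -
    have "(\<Sum>i=1..p. log_potential (y p i)) \<le> (\<Sum>i=1..p. real p * enn2real (c p i) + \<epsilon>)"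
    proof (rule sum_mono)
      fix i assume i: "i \<in> {1..p}"
      have "ennreal (log_potential (y p i)) \<le> ennreal (real p * enn2real (c p i) + \<epsilon>)"
        using Vt[OF p i] ypos[OF p i] by (simp add: y_def[symmetric] potential_nonzero)
      then show "log_potential (y p i) \<le> real p * enn2real (c p i) + \<epsilon>"
        using \<epsilon> by (subst (asm) ennreal_le_iff) (auto intro!: add_nonneg_nonneg)
    qed
    also have "\<dots> = real p * (\<Sum>i=1..p. enn2real (c p i)) + real p * \<epsilon>"
      by (simp add: sum.distrib sum_distrib_left)
    also have "(\<Sum>i=1..p. enn2real (c p i)) = enn2real (\<Sum>i=1..p. c p i)"
      using c_fin[OF p] by (subst enn2real_sum) (auto simp: o_def)
    also have "real p * enn2real (\<Sum>i=1..p. c p i) + real p * \<epsilon> \<le> real p * G + real p * \<epsilon>"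
    proof -
      have "1 \<le> ennreal G"
        using \<mu> by (intro order_trans[OF nn_integral_potential_ge_1 G]) (simp add: sym_prob_measures_def)
      then have "0 \<le> G" by (metis ennreal_neg linorder_le_cases not_one_le_zero)
      then have "enn2real (\<Sum>i=1..p. c p i) \<le> G"
        using sum_c[OF p] by (intro enn2real_leI)
      then show ?thesis by (intro add_right_mono mult_left_mono) auto
    qed
    finally show ?thesis by (simp add: algebra_simps)
  qed
  define emp where "emp p = distr (measure_pmf (pmf_of_set {1..p})) borel (y p)" for p
  have rd_emp: "real_distribution (emp (Suc p))" for p
    unfolding emp_def by (auto simp: real_distribution_def real_distribution_axioms_def
        intro!: prob_space.prob_space_distr prob_space_measure_pmf)
  have cdf_emp: "\<bar>cdf (emp p) x - cdf \<nu> x\<bar> \<le> 1 / real p" if p: "1 \<le> p" for p x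
  proof -
    have "cdf (emp p) x = measure_pmf.prob (pmf_of_set {1..p}) (y p -` {..x})"
      unfolding cdf_def emp_def by (subst measure_distr) auto
    also have "\<dots> = real (card ({1..p} \<inter> y p -` {..x})) / real p"
      using p by (subst measure_pmf_of_set) auto
    also have "{1..p} \<inter> y p -` {..x} = {i \<in> {1..p}. t p i \<le> cdf \<nu> x}"
      using \<nu>.pseudoinverse[of _ x] t01[OF p] by (auto simp: y_def)
    finally show ?thesis
      using card_grid_bounds[OF p, of "t p" "cdf \<nu> x"] t[OF p] \<nu>.cdf_nonneg \<nu>.cdf_bounded_prob
      by (auto simp: bin_def)
  qed
  have "weak_conv_m (\<lambda>p. emp (Suc p)) \<nu>"
    unfolding weak_conv_m_def weak_conv_def
  proof (intro allI impI)
    fix x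
    have lim: "(\<lambda>p. 1 / real (Suc p)) \<longlonglongrightarrow> 0" by real_asymp
    have "norm (cdf (emp (Suc p)) x - cdf \<nu> x) \<le> 1 / real (Suc p)" for p
      unfolding real_norm_def by (rule cdf_emp) simp
    then have "(\<lambda>p. cdf (emp (Suc p)) x - cdf \<nu> x) \<longlonglongrightarrow> 0"
      by (intro Lim_null_comparison[OF _ lim] always_eventually allI)
    then show "(\<lambda>p. cdf (emp (Suc p)) x) \<longlonglongrightarrow> cdf \<nu> x" by (rule LIM_zero_cancel)
  qed
  note wc = weak_conv_imp_integral_bdd_continuous_conv[OF rd_emp \<nu>.real_distribution_axioms this]
  have rd_se: "real_distribution (sym_empirical (Suc p) (y (Suc p)))" for p
    using sym_empirical_prob[of "Suc p" "y (Suc p)"] by (simp add: sym_prob_measures_iff)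
  have "weak_conv_m (\<lambda>p. sym_empirical (Suc p) (y (Suc p))) \<mu>"
  proof (rule integral_bdd_continuous_conv_imp_weak_conv[OF rd_se \<mu>.real_distribution_axioms])
    fix f :: "real \<Rightarrow> real" assume f: "\<And>x. isCont f x" "\<And>x. \<bar>f x\<bar> \<le> 1"
    have fm [measurable]: "f \<in> borel_measurable borel"
      using f(1) by (intro borel_measurable_continuous_onI continuous_at_imp_continuous_on) auto
    \<comment> \<open>The even part is the same under \<open>\<mu>\<close> and under the law of \<open>\<bar>x\<bar>\<close>.\<close>
    define h where "h x = (f x + f (- x)) / 2" for x
    have hm [measurable]: "h \<in> borel_measurable borel" unfolding h_def by measurable
    have "isCont (\<lambda>x. f (- x)) x" for x
      by (rule isCont_o2[where f=uminus and g=f, OF _ f(1)]) simp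
    then have hc: "isCont h x" for x
      unfolding h_def by (intro continuous_intros f(1)) auto
    have hb: "\<bar>h x\<bar> \<le> 1" for x using f(2)[of x] f(2)[of "- x"] by (simp add: h_def abs_le_iff)
    have "(\<lambda>p. \<integral>x. h x \<partial>emp (Suc p)) \<longlonglongrightarrow> (\<integral>x. h x \<partial>\<nu>)"
      by (rule wc[where B=1]) (use hc hb in auto)
    moreover have "(\<integral>x. h x \<partial>emp (Suc p)) = (\<integral>x. f x \<partial>sym_empirical (Suc p) (y (Suc p)))" for p
      unfolding emp_def by (subst integral_distr, simp, simp, subst integral_pmf_of_set)
        (simp_all add: integral_sym_empirical h_def del: sum.cl_ivl_Suc)
    moreover have "(\<integral>x. h x \<partial>\<nu>) = (\<integral>x. f x \<partial>\<mu>)"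
    proof -
      have "(\<integral>x. h x \<partial>\<nu>) = (\<integral>x. h \<bar>x\<bar> \<partial>\<mu>)" unfolding \<nu>_def by (subst integral_distr) auto
      also have "\<dots> = (\<integral>x. h x \<partial>\<mu>)" by (intro Bochner_Integration.integral_cong) (auto simp: h_def abs_if)
      also have "\<dots> = (\<integral>x. f x \<partial>\<mu>)" unfolding h_def by (rule integral_even_part[symmetric, OF \<mu> fm f(2)])
      finally show ?thesis .
    qed
    ultimately show "(\<lambda>p. \<integral>x. f x \<partial>sym_empirical (Suc p) (y (Suc p))) \<longlonglongrightarrow> (\<integral>x. f x \<partial>\<mu>)" by simp
  qed
  \<comment> \<open>For \<open>p = 0\<close> the empirical measure is no probability measure, hence the index shift.\<close>
  from weak_conv_m_imp_d_BL[OF rd_se \<mu>.real_distribution_axioms this]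
  have "(\<lambda>p. d_BL (sym_empirical p (y p)) \<mu>) \<longlonglongrightarrow> 0" by (rule LIMSEQ_imp_Suc)
  with ypos ymono ysum show ?thesis by (rule that)
qed

section \<open>Exponential asymptotics\<close>

text \<open>The growth conditions on \<open>p\<close>. Both terms of order \<open>p\<^sup>2\<close> and the term \<open>p ln p\<close> that comes from volumes are
  then \<open>o(p n)\<close>.\<close>

locale sv_regime =
  fixes p :: "nat \<Rightarrow> nat"
  assumes p_bounds: "\<And>n. 1 \<le> n \<Longrightarrow> 1 \<le> p n \<and> p n \<le> n"
    and p_at_top: "filterlim p at_top sequentially"
    and p_ratio: "(\<lambda>n. real (p n) / real n) \<longlonglongrightarrow> 0"
begin

lemma lower_order:
  assumes M: "1 \<le> M" and \<eta>: "0 < \<eta>"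
  shows "\<forall>\<^sub>F n in sequentially. (real (p n))\<^sup>2 * K + real (p n) * L + real (p n) * ln (M * real (p n))
     \<le> \<eta> * (real (p n) * real n)"
proof -
  have "(\<lambda>n. (L + ln (M * real n)) / real n) \<longlonglongrightarrow> 0" using M by real_asymp
  from tendsto_add[OF tendsto_mult[OF p_ratio tendsto_const[of K]] this]
  have "(\<lambda>n. real (p n) / real n * K + (L + ln (M * real n)) / real n) \<longlonglongrightarrow> 0" by simp
  from order_tendstoD(2)[OF this \<eta>]
  have "\<forall>\<^sub>F n in sequentially. real (p n) / real n * K + (L + ln (M * real n)) / real n < \<eta>" .
  then show ?thesis
    using eventually_ge_at_top[of 1]
  proof eventually_elim
    case (elim n)
    then have n: "0 < real n" and pn: "1 \<le> real (p n)" "real (p n) \<le> real n" using p_bounds[of n] by auto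
    have "real (p n) * K + (L + ln (M * real n)) = real n * (real (p n) / real n * K + (L + ln (M * real n)) / real n)"
      using n by (simp add: field_simps)
    also have "\<dots> \<le> real n * \<eta>" using elim n by (intro mult_left_mono) auto
    finally have "real (p n) * K + (L + ln (M * real n)) \<le> real n * \<eta>" .
    moreover have "ln (M * real (p n)) \<le> ln (M * real n)" using pn M by (subst ln_le_cancel_iff) auto
    ultimately have "real (p n) * K + (L + ln (M * real (p n))) \<le> real n * \<eta>" by linarith
    then have "real (p n) * (real (p n) * K + (L + ln (M * real (p n)))) \<le> real (p n) * (real n * \<eta>)"
      by (rule mult_left_mono) simp
    then show ?case by (simp add: power2_eq_square algebra_simps)
  qed
qed

lemma lower_order_quadratic:
  assumes "0 < \<eta>"
  shows "\<forall>\<^sub>F n in sequentially. (real (p n))\<^sup>2 * K + real (p n) * L \<le> \<eta> * (real (p n) * real n)"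
  using lower_order[OF order_refl assms, of K L] eventually_ge_at_top[of 1]
proof eventually_elim
  case (elim n)
  have "0 \<le> real (p n) * ln (1 * real (p n))" using p_bounds[OF elim(2)] by simp
  with elim(1) show ?case by linarith
qed

lemma eventually_p_add_2_le: "\<forall>\<^sub>F n in sequentially. p n + 2 \<le> n"
  using lower_order_quadratic[OF zero_less_one, of 1 2] eventually_ge_at_top[of 1]
proof eventually_elim
  case (elim n)
  then have "real (p n) * (real (p n) + 2) \<le> real (p n) * real n"
    by (simp add: power2_eq_square algebra_simps)
  then have "real (p n) + 2 \<le> real n" using p_bounds[OF elim(2)] by simp
  then have "real (p n + 2) \<le> real n" by simp
  then show ?case by (simp only: of_nat_le_iff)
qed

lemma eventually_sv_mass_le:
  assumes \<eta>: "0 < \<eta>"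
  shows "\<forall>\<^sub>F n in sequentially. \<forall>A\<in>sets (lebesgue_vec (p n)).
    (\<forall>s\<in>A. (\<forall>i\<in>{1..p n}. s i \<noteq> 0) \<longrightarrow> real (p n) * v \<le> (\<Sum>i=1..p n. log_potential (s i)))
    \<longrightarrow> sv_mass (p n) n A \<le> ennreal (exp (- (real (p n) * real n * (v - \<eta>))))"
  using lower_order_quadratic[OF \<eta>, of "1 + v" "2 * v"] eventually_p_add_2_le
proof eventually_elim
  case (elim n)
  have "(real (p n))\<^sup>2 - real (n - p n - 2) * (real (p n) * v)
      = - (real (p n) * real n * v) + ((real (p n))\<^sup>2 * (1 + v) + real (p n) * (2 * v))"
    using elim(2) by (simp add: of_nat_diff power2_eq_square algebra_simps)
  also have "\<dots> \<le> - (real (p n) * real n * v) + \<eta> * (real (p n) * real n)"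
    using elim(1) by linarith
  also have "\<dots> = - (real (p n) * real n * (v - \<eta>))" by (simp add: algebra_simps)
  finally have le: "(real (p n))\<^sup>2 - real (n - p n - 2) * (real (p n) * v) \<le> - (real (p n) * real n * (v - \<eta>))" .
  show ?case
  proof (intro ballI impI)
    fix A assume A: "A \<in> sets (lebesgue_vec (p n))"
      and V: "\<forall>s\<in>A. (\<forall>i\<in>{1..p n}. s i \<noteq> 0) \<longrightarrow> real (p n) * v \<le> (\<Sum>i=1..p n. log_potential (s i))"
    have "sv_mass (p n) n A \<le> ennreal (exp ((real (p n))\<^sup>2 - real (n - p n - 2) * (real (p n) * v)))"
      using V by (intro sv_mass_le[OF elim(2) A]) blast
    also have "\<dots> \<le> ennreal (exp (- (real (p n) * real n * (v - \<eta>))))"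
      using le by (intro ennreal_leI) simp
    finally show "sv_mass (p n) n A \<le> ennreal (exp (- (real (p n) * real n * (v - \<eta>))))" .
  qed
qed

text \<open>Uniformity over all \<open>y\<close> matters, since the quantile points change with \<open>n\<close>.\<close>

lemma eventually_sv_mass_spread_box_ge:
  assumes \<delta>: "0 < \<delta>" "\<delta> \<le> 1"
  shows "\<forall>\<^sub>F n in sequentially. \<forall>y. (\<forall>i\<in>{1..p n}. 0 < y i) \<longrightarrow>
    (\<forall>i j. 1 \<le> i \<longrightarrow> i < j \<longrightarrow> j \<le> p n \<longrightarrow> y i \<le> y j) \<longrightarrow> (\<Sum>i=1..p n. log_potential (y i)) \<le> real (p n) * G \<longrightarrow>
    ennreal (exp (- (real (p n) * real n * (G + \<delta> * (4 * G + 7))))) \<le> sv_mass (p n) n (spread_box (p n) \<delta> y)"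
proof -
  have M: "1 \<le> 2 / \<delta>" using \<delta> by simp
  show ?thesis
    using lower_order[OF M \<delta>(1), of "6 * G + 10 + 4 * ln (2 / \<delta>)" 0] eventually_ge_at_top[of 1]
  proof eventually_elim
    case (elim n)
    have p: "1 \<le> p n" "p n \<le> n" using p_bounds[OF elim(2)] by auto
    have le: "- (real (p n) * real n * (G + \<delta> * (4 * G + 7)))
        \<le> - (real (p n) * real n * (G + \<delta> * (4 * G + 6))) - (real (p n))\<^sup>2 * (6 * G + 10 + 4 * ln (2 / \<delta>))
          - real (p n) * ln (2 * real (p n) / \<delta>)"
      using elim(1) by (simp add: algebra_simps)
    show ?case
    proof (intro allI impI)
      fix y :: "nat \<Rightarrow> real"
      assume y: "\<forall>i\<in>{1..p n}. 0 < y i" "\<forall>i j. 1 \<le> i \<longrightarrow> i < j \<longrightarrow> j \<le> p n \<longrightarrow> y i \<le> y j"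
        "(\<Sum>i=1..p n. log_potential (y i)) \<le> real (p n) * G"
      have "ennreal (exp (- (real (p n) * real n * (G + \<delta> * (4 * G + 7)))))
        \<le> ennreal (exp (- (real (p n) * real n * (G + \<delta> * (4 * G + 6))) - (real (p n))\<^sup>2 * (6 * G + 10 + 4 * ln (2 / \<delta>))
          - real (p n) * ln (2 * real (p n) / \<delta>)))"
        using le by (intro ennreal_leI) simp
      also have "\<dots> \<le> sv_mass (p n) n (spread_box (p n) \<delta> y)"
        by (rule sv_mass_spread_box_ge[OF p \<delta> _ _ y(3)]) (use y(1,2) in blast)+
      finally show "ennreal (exp (- (real (p n) * real n * (G + \<delta> * (4 * G + 7)))))
          \<le> sv_mass (p n) n (spread_box (p n) \<delta> y)" .
    qed
  qed
qed

text \<open>The box at \<open>y\<^sub>i = 1\<close>, where the potential attains its minimum 1.\<close>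

lemma eventually_sv_norm_const_ge:
  assumes \<eta>: "0 < \<eta>"
  shows "\<forall>\<^sub>F n in sequentially. ennreal (exp (- (real (p n) * real n * (1 + \<eta>)))) \<le> sv_norm_const (p n) n"
proof -
  \<comment> \<open>For \<open>G = 1\<close> the error term is \<open>\<delta> (4 G + 7) = 11 \<delta>\<close>.\<close>
  define \<delta> where "\<delta> = min 1 (\<eta> / 11)"
  have \<delta>: "0 < \<delta>" "\<delta> \<le> 1" "\<delta> * 11 \<le> \<eta>" using \<eta> by (auto simp: \<delta>_def min_def field_simps)
  show ?thesis
    using eventually_sv_mass_spread_box_ge[OF \<delta>(1,2), of 1]
  proof eventually_elim
    case (elim n)
    have "real (p n) * real n * (1 + \<delta> * (4 * 1 + 7)) \<le> real (p n) * real n * (1 + \<eta>)"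
      using \<delta>(3) by (intro mult_left_mono) auto
    then have "ennreal (exp (- (real (p n) * real n * (1 + \<eta>)))) \<le>
        ennreal (exp (- (real (p n) * real n * (1 + \<delta> * (4 * 1 + 7)))))"
      by (intro ennreal_leI) simp
    also have "\<dots> \<le> sv_mass (p n) n (spread_box (p n) \<delta> (\<lambda>_. 1))"
      using elim[rule_format, of "\<lambda>_. 1"] by simp
    also have "\<dots> \<le> sv_norm_const (p n) n"
      unfolding sv_norm_const_eq by (intro sv_mass_mono sets.sets_into_space sets_spread_box)
    finally show ?case .
  qed
qed

lemma eventually_sv_norm_const_le:
  assumes \<eta>: "0 < \<eta>"
  shows "\<forall>\<^sub>F n in sequentially. sv_norm_const (p n) n \<le> ennreal (exp (- (real (p n) * real n * (1 - \<eta>))))"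
  using eventually_sv_mass_le[OF \<eta>, of 1]
proof eventually_elim
  case (elim n)
  have "real (p n) * 1 \<le> (\<Sum>i=1..p n. log_potential (s i))" if "\<forall>i\<in>{1..p n}. s i \<noteq> 0" for s
    using sum_mono[of "{1..p n}" "\<lambda>_. 1::real" "\<lambda>i. log_potential (s i)"] log_potential_ge_1 that by simp
  then show ?case using elim unfolding sv_norm_const_eq by blast
qed

end

section \<open>The large deviation principle\<close>

lemma ext_ln_ge: "exp x \<le> P \<Longrightarrow> ereal x \<le> ext_ln P"
  using less_le_trans[OF exp_gt_zero[of x], of P] ln_ge_iff[of P x] by (auto simp: ext_ln_def)

lemma ext_ln_le: "0 \<le> P \<Longrightarrow> P \<le> exp x \<Longrightarrow> ext_ln P \<le> ereal x"
  using ln_le_cancel_iff[of P "exp x"] by (auto simp: ext_ln_def)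

lemma enn2real_divide_ge:
  assumes "ennreal a \<le> A" "A \<le> D" "0 < D" "D \<le> ennreal d" "0 < d" "0 \<le> a"
  shows "a / d \<le> enn2real (A / D)"
proof -
  have "D < top" using assms(4) by (meson ennreal_less_top le_less_trans)
  then obtain D' where D: "D = ennreal D'" "0 < D'" using assms(3) by (cases D) auto
  obtain A' where A: "A = ennreal A'" "0 \<le> A'" using assms(2) D by (cases A) (auto simp: top_unique)
  have "a \<le> A'" "D' \<le> d" using assms A D by (auto simp: ennreal_le_iff)
  then have "a / d \<le> A' / D'" using D A assms by (intro frac_le) auto
  then show ?thesis using A D by (simp add: divide_ennreal)
qed

lemma enn2real_divide_le:
  assumes "A \<le> ennreal a" "ennreal d \<le> D" "D < top" "0 < d" "0 \<le> a"
  shows "enn2real (A / D) \<le> a / d"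
proof -
  obtain D' where D: "D = ennreal D'" "0 \<le> D'" using assms(3) by (cases D) auto
  then have "d \<le> D'" using assms by (simp add: ennreal_le_iff)
  obtain A' where A: "A = ennreal A'" "0 \<le> A'" using assms(1) by (cases A) (auto simp: top_unique)
  then have "A' \<le> a" using assms by (simp add: ennreal_le_iff)
  then have "A' / D' \<le> a / d" using \<open>d \<le> D'\<close> A assms by (intro frac_le) auto
  then show ?thesis using A D \<open>d \<le> D'\<close> assms(4) by (simp add: divide_ennreal)
qed

locale sv_sample = sv_regime +
  fixes \<Omega> :: "nat \<Rightarrow> 'w measure" and s :: "nat \<Rightarrow> 'w \<Rightarrow> nat \<Rightarrow> real"
  assumes prob: "\<And>n. 1 \<le> n \<Longrightarrow> prob_space (\<Omega> n)"
    and distributed: "\<And>n. 1 \<le> n \<Longrightarrow>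
      distributed (\<Omega> n) (lebesgue_vec (p n)) (\<lambda>\<omega>. \<lambda>i\<in>{1..p n}. s n \<omega> i) (sv_density (p n) n)"
begin

definition law :: "nat \<Rightarrow> real measure measure" where
  "law n = distr (\<Omega> n) (borel_of sym_weak_topology) (\<lambda>\<omega>. sym_empirical (p n) (s n \<omega>))"

lemma measure_law:
  assumes "1 \<le> n" "U \<in> sets (borel_of sym_weak_topology)"
  shows "measure (law n) U = enn2real (sv_mass (p n) n (sym_empirical (p n) -` U \<inter> space (lebesgue_vec (p n)))
    / sv_norm_const (p n) n)"
  unfolding law_def using assms p_bounds by (intro measure_distr_sym_empirical prob distributed) auto

text \<open>A box around the quantile points of \<open>\<mu>\<close> lies in the preimage of \<open>U\<close>. Its weight supplies
  \<open>exp (- p n (g + 1 + \<eta>))\<close>, and dividing by the normalizing constant removes the 1.\<close>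

lemma LDP_lower:
  assumes U: "openin sym_weak_topology U" and \<mu>: "\<mu> \<in> U" and I: "I_sym \<mu> = ereal g" and \<eta>: "0 < \<eta>"
  shows "\<forall>\<^sub>F n in sequentially. exp (- (real (p n) * real n * (g + 2 * \<eta>))) \<le> measure (law n) U"
proof -
  have \<mu>s: "\<mu> \<in> sym_prob_measures" using openin_subset[OF U] \<mu> by (auto simp: topspace_sym_weak_topology)
  then have g: "0 \<le> g" using I_sym_nonneg[of \<mu>] I by (simp add: sym_prob_measures_def)
  define G where "G = g + 1"
  have G: "(\<integral>\<^sup>+ x. potential x \<partial>\<mu>) \<le> ennreal G" using I_sym_le_iff[of g \<mu>] I g by (simp add: G_def)
  from U \<mu> obtain r where r: "0 < r" "\<And>\<nu>. \<nu> \<in> sym_prob_measures \<Longrightarrow> d_BL \<mu> \<nu> < r \<Longrightarrow> \<nu> \<in> U"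
    by (auto simp: openin_sym_weak_topology_iff)
  \<comment> \<open>The bound \<open>r / 4\<close> keeps the box within distance \<open>r / 2\<close> of the quantile points; the last bound makes
    all errors in the exponent, including the slack \<open>\<delta>\<close> in the quantile points, at most \<open>\<eta>\<close>.\<close>
  define \<delta> where "\<delta> = min (min 1 (r / 4)) (\<eta> / (4 * G + 12))"
  have \<delta>: "0 < \<delta>" "\<delta> \<le> 1" "2 * \<delta> \<le> r / 2" "\<delta> \<le> \<eta> / (4 * G + 12)"
    using \<eta> r(1) g by (auto simp: \<delta>_def G_def)
  have small: "(G + \<delta>) + \<delta> * (4 * (G + \<delta>) + 7) \<le> G + \<eta>"
  proof -
    have "\<delta> * \<delta> \<le> \<delta> * 1" using \<delta> by (intro mult_left_mono) auto
    then have "(G + \<delta>) + \<delta> * (4 * (G + \<delta>) + 7) \<le> G + \<delta> * (4 * G + 12)" by (simp add: algebra_simps)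
    moreover have "\<delta> * (4 * G + 12) \<le> \<eta>" using \<delta>(4) g by (simp add: G_def pos_le_divide_eq)
    ultimately show ?thesis by simp
  qed
  obtain y where y: "\<And>p i. 1 \<le> p \<Longrightarrow> i \<in> {1..p} \<Longrightarrow> 0 < y p i"
    "\<And>p i j. 1 \<le> i \<Longrightarrow> i < j \<Longrightarrow> j \<le> p \<Longrightarrow> y p i \<le> y p j"
    "\<And>p. 1 \<le> p \<Longrightarrow> (\<Sum>i=1..p. log_potential (y p i)) \<le> real p * (G + \<delta>)"
    "(\<lambda>p. d_BL (sym_empirical p (y p)) \<mu>) \<longlonglongrightarrow> 0"
    using quantile_points[OF \<mu>s G \<delta>(1)] by blast
  have "\<forall>\<^sub>F p in sequentially. d_BL (sym_empirical p (y p)) \<mu> < r / 2"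
    using r by (intro order_tendstoD(2)[OF y(4)]) auto
  then have "\<forall>\<^sub>F n in sequentially. d_BL (sym_empirical (p n) (y (p n))) \<mu> < r / 2"
    by (rule eventually_compose_filterlim[OF _ p_at_top])
  then show ?thesis
    using eventually_sv_mass_spread_box_ge[OF \<delta>(1,2), of "G + \<delta>"] eventually_sv_norm_const_le[OF \<eta>]
      eventually_ge_at_top[of 1]
  proof eventually_elim
    case (elim n)
    let ?A = "sym_empirical (p n) -` U \<inter> space (lebesgue_vec (p n))"
    let ?B = "spread_box (p n) \<delta> (y (p n))"
    have pn: "1 \<le> p n" using p_bounds[OF elim(4)] by simp
    interpret B: Metric_space prob_measures d_BL by (rule Metric_space_d_BL)
    have sub: "?B \<subseteq> ?A"
    proof
      fix t assume t: "t \<in> ?B"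
      have "\<bar>y (p n) i - t i\<bar> \<le> r / 2" if "i \<in> {1..p n}" for i
        using spread_box_close[OF pn \<delta>(1) t that] \<delta>(3) by auto
      then have "d_BL (sym_empirical (p n) (y (p n))) (sym_empirical (p n) t) \<le> r / 2"
        by (rule d_BL_sym_empirical_le[OF pn])
      moreover have "d_BL \<mu> (sym_empirical (p n) t) \<le> d_BL \<mu> (sym_empirical (p n) (y (p n)))
          + d_BL (sym_empirical (p n) (y (p n))) (sym_empirical (p n) t)"
        using \<mu>s sym_empirical_prob[OF pn] by (intro B.triangle) (auto simp: sym_prob_measures_def)
      ultimately have "d_BL \<mu> (sym_empirical (p n) t) < r"
        using elim(1) B.commute[of \<mu> "sym_empirical (p n) (y (p n))"] by linarith
      then have "sym_empirical (p n) t \<in> U" by (rule r(2)[OF sym_empirical_prob[OF pn]])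
      then show "t \<in> ?A" using t sets.sets_into_space[OF sets_spread_box] by blast
    qed
    have "real (p n) * real n * ((G + \<delta>) + \<delta> * (4 * (G + \<delta>) + 7)) \<le> real (p n) * real n * (G + \<eta>)"
      using small by (intro mult_left_mono) auto
    then have "ennreal (exp (- (real (p n) * real n * (G + \<eta>))))
        \<le> ennreal (exp (- (real (p n) * real n * ((G + \<delta>) + \<delta> * (4 * (G + \<delta>) + 7)))))"
      by (intro ennreal_leI) simp
    also have "\<dots> \<le> sv_mass (p n) n ?B"
      using elim(2) y(1)[OF pn] y(2) y(3)[OF pn] by blast
    also have "\<dots> \<le> sv_mass (p n) n ?A" by (rule sv_mass_mono[OF sub])
    finally have "exp (- (real (p n) * real n * (G + \<eta>))) / exp (- (real (p n) * real n * (1 - \<eta>)))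
        \<le> enn2real (sv_mass (p n) n ?A / sv_norm_const (p n) n)"
      using elim(3) distributed_sv_density(1)[OF prob distributed] elim(4)
      by (intro enn2real_divide_ge) (auto simp: sv_norm_const_eq intro!: sv_mass_mono)
    moreover have "exp (- (real (p n) * real n * (G + \<eta>))) / exp (- (real (p n) * real n * (1 - \<eta>)))
        = exp (- (real (p n) * real n * (g + 2 * \<eta>)))"
      unfolding exp_diff[symmetric] by (rule arg_cong[where f=exp]) (simp add: G_def algebra_simps)
    ultimately show ?case using measure_law[OF elim(4) openin_imp_sets_borel_of[OF U]] by simp
  qed
qed

text \<open>On the preimage of \<open>F\<close> the average potential is at least \<open>c + 1\<close>, again up to the 1 that the
  normalizing constant takes away.\<close>

lemma LDP_upper:
  assumes F: "closedin sym_weak_topology F" and c: "\<And>\<mu>. \<mu> \<in> F \<Longrightarrow> ereal c \<le> I_sym \<mu>" and \<eta>: "0 < \<eta>"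
  shows "\<forall>\<^sub>F n in sequentially. measure (law n) F \<le> exp (- (real (p n) * real n * (c - 2 * \<eta>)))"
  using eventually_sv_mass_le[OF \<eta>, of "c + 1"] eventually_sv_norm_const_ge[OF \<eta>] eventually_ge_at_top[of 1]
proof eventually_elim
  case (elim n)
  let ?A = "sym_empirical (p n) -` F \<inter> space (lebesgue_vec (p n))"
  have pn: "1 \<le> p n" using p_bounds[OF elim(3)] by simp
  have Fs: "F \<in> sets (borel_of sym_weak_topology)" by (rule closedin_imp_sets_borel_of[OF F])
  have A: "?A \<in> sets (lebesgue_vec (p n))"
    by (rule measurable_sets[OF measurable_sym_empirical[OF pn] Fs])
  have "real (p n) * (c + 1) \<le> (\<Sum>i=1..p n. log_potential (t i))" if t: "t \<in> ?A" "\<forall>i\<in>{1..p n}. t i \<noteq> 0" for t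
  proof -
    define v where "v = (\<Sum>i=1..p n. log_potential (t i)) / real (p n)"
    have "real (p n) * 1 \<le> (\<Sum>i=1..p n. log_potential (t i))"
      using sum_mono[of "{1..p n}" "\<lambda>_. 1::real" "\<lambda>i. log_potential (t i)"] log_potential_ge_1 t(2) by simp
    then have v: "1 \<le> v" "(\<Sum>i=1..p n. log_potential (t i)) = real (p n) * v" using pn by (auto simp: v_def le_divide_eq)
    then have "I_sym (sym_empirical (p n) t) \<le> ereal (v - 1)"
      using t(2) by (subst I_sym_sym_empirical_le_iff[OF pn]) auto
    moreover have "ereal c \<le> I_sym (sym_empirical (p n) t)" using t(1) by (intro c) auto
    ultimately have "ereal c \<le> ereal (v - 1)" by (rule order_trans[rotated])
    then have "c + 1 \<le> v" by simp
    then show ?thesis unfolding v(2) by (intro mult_left_mono) auto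
  qed
  then have "sv_mass (p n) n ?A \<le> ennreal (exp (- (real (p n) * real n * (c + 1 - \<eta>))))"
    using elim(1) A by blast
  then have "enn2real (sv_mass (p n) n ?A / sv_norm_const (p n) n)
      \<le> exp (- (real (p n) * real n * (c + 1 - \<eta>))) / exp (- (real (p n) * real n * (1 + \<eta>)))"
    using elim(2) distributed_sv_density(2)[OF prob distributed] elim(3)
    by (intro enn2real_divide_le) auto
  also have "\<dots> = exp (- (real (p n) * real n * (c - 2 * \<eta>)))"
    unfolding exp_diff[symmetric] by (rule arg_cong[where f=exp]) (simp add: algebra_simps)
  finally show ?case using measure_law[OF elim(3) Fs] by simp
qed

lemma satisfies_LDP_I_sym:
  "satisfies_LDP sym_weak_topology \<Omega> (\<lambda>n \<omega>. sym_empirical (p n) (s n \<omega>)) (\<lambda>n. real (p n * n)) I_sym"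
  unfolding satisfies_LDP_def law_def[symmetric]
proof (intro conjI allI impI)
  fix n :: nat assume n: "1 \<le> n"
  show "prob_space (\<Omega> n)" by (rule prob[OF n])
  show "(\<lambda>\<omega>. sym_empirical (p n) (s n \<omega>)) \<in> \<Omega> n \<rightarrow>\<^sub>M borel_of sym_weak_topology"
    using p_bounds[OF n] by (intro measurable_sym_empirical_sample[OF _ prob[OF n] distributed[OF n]]) simp
next
  show "filterlim (\<lambda>n. real (p n * n)) at_top sequentially"
  proof (rule filterlim_at_top_mono[OF filterlim_real_sequentially])
    show "\<forall>\<^sub>F n in sequentially. real n \<le> real (p n * n)"
      using eventually_ge_at_top[of 1] by eventually_elim (use p_bounds in auto)
  qed
  show "rate_function sym_weak_topology I_sym" by (rule rate_function_I_sym)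
next
  fix U assume U: "openin sym_weak_topology U"
  let ?L = "liminf (\<lambda>n. ereal (1 / real (p n * n)) * ext_ln (measure (law n) U))"
  have "- I_sym \<mu> \<le> ?L" if \<mu>: "\<mu> \<in> U" for \<mu>
  proof (cases "I_sym \<mu>")
    case (real g)
    show ?thesis
    proof (rule ereal_le_epsilon2)
      fix e :: real assume e: "0 < e"
      have "\<forall>\<^sub>F n in sequentially. ereal (- (g + e)) \<le> ereal (1 / real (p n * n)) * ext_ln (measure (law n) U)"
        using LDP_lower[OF U \<mu> real half_gt_zero[OF e]] eventually_ge_at_top[of 1]
      proof eventually_elim
        case (elim n)
        have pn: "0 < p n" "0 < n" using p_bounds[OF elim(2)] elim(2) by auto
        have "ereal (- (g + e)) = ereal (1 / real (p n * n)) * ereal (- (real (p n) * real n * (g + 2 * (e / 2))))"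
          using pn by simp
        also have "\<dots> \<le> ereal (1 / real (p n * n)) * ext_ln (measure (law n) U)"
          using ext_ln_ge[OF elim(1)] by (intro ereal_mult_left_mono) auto
        finally show ?case .
      qed
      then have "ereal (- (g + e)) \<le> ?L" by (rule Liminf_bounded)
      then have "ereal (- (g + e)) + ereal e \<le> ?L + ereal e" by (rule add_right_mono)
      then show "- I_sym \<mu> \<le> ?L + ereal e" by (simp add: real)
    qed
  next
    case MInf
    have "\<mu> \<in> prob_measures"
      using openin_subset[OF U] \<mu> by (auto simp: topspace_sym_weak_topology sym_prob_measures_def)
    then show ?thesis using I_sym_nonneg[of \<mu>] MInf by simp
  qed simp
  then show "- (INF x\<in>U. I_sym x) \<le> ?L"
    unfolding ereal_SUP_uminus_eq[symmetric] by (rule SUP_least)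
next
  fix F assume F: "closedin sym_weak_topology F"
  let ?L = "limsup (\<lambda>n. ereal (1 / real (p n * n)) * ext_ln (measure (law n) F))"
  have le: "?L \<le> ereal (- c)" if c: "ereal c \<le> (INF x\<in>F. I_sym x)" for c
  proof (rule ereal_le_epsilon2)
    fix e :: real assume e: "0 < e"
    have cI: "ereal c \<le> I_sym \<mu>" if "\<mu> \<in> F" for \<mu>
      using c that by (meson INF_lower order_trans)
    have "\<forall>\<^sub>F n in sequentially. measure (law n) F \<le> exp (- (real (p n) * real n * (c - 2 * (e / 2))))"
      by (rule LDP_upper[OF F cI half_gt_zero[OF e]])
    then have "\<forall>\<^sub>F n in sequentially. ereal (1 / real (p n * n)) * ext_ln (measure (law n) F) \<le> ereal (- c + e)"
      using eventually_ge_at_top[of 1]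
    proof eventually_elim
      case (elim n)
      have pn: "0 < p n" "0 < n" using p_bounds[OF elim(2)] elim(2) by auto
      have "ereal (1 / real (p n * n)) * ext_ln (measure (law n) F)
          \<le> ereal (1 / real (p n * n)) * ereal (- (real (p n) * real n * (c - 2 * (e / 2))))"
        using ext_ln_le[OF measure_nonneg elim(1)] by (intro ereal_mult_left_mono) auto
      also have "\<dots> = ereal (- c + e)" using pn by simp
      finally show ?case .
    qed
    then have "?L \<le> ereal (- c + e)" by (rule Limsup_bounded)
    then show "?L \<le> ereal (- c) + ereal e" by simp
  qed
  have nn: "0 \<le> (INF x\<in>F. I_sym x)"
    using closedin_subset[OF F] by (intro INF_greatest I_sym_nonneg) (auto simp: topspace_sym_weak_topology sym_prob_measures_def)
  show "?L \<le> - (INF x\<in>F. I_sym x)"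
  proof (cases "INF x\<in>F. I_sym x")
    case (real c)
    then show ?thesis using le[of c] by simp
  next
    case PInf
    have "?L \<le> ereal B" for B using le[of "- B"] PInf by simp
    then have "?L = - \<infinity>" by (rule ereal_bot)
    then show ?thesis by simp
  qed (use nn in simp)
qed

end

theorem theorem1p2:
  fixes p :: "nat \<Rightarrow> nat"
    and \<Omega> :: "nat \<Rightarrow> 'w measure"
    and s :: "nat \<Rightarrow> 'w \<Rightarrow> nat \<Rightarrow> real"
  assumes "\<And>n. 1 \<le> n \<Longrightarrow> 1 \<le> p n \<and> p n \<le> n"
    and "filterlim p at_top sequentially"
    and "(\<lambda>n. real (p n) / real n) \<longlonglongrightarrow> 0"
    and "\<And>n. 1 \<le> n \<Longrightarrow> prob_space (\<Omega> n)"
    and "\<And>n. 1 \<le> n \<Longrightarrow>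
      distributed (\<Omega> n) (lebesgue_vec (p n)) (\<lambda>\<omega>. \<lambda>i\<in>{1..p n}. s n \<omega> i) (sv_density (p n) n)"
  shows "satisfies_LDP sym_weak_topology \<Omega> (\<lambda>n \<omega>. sym_empirical (p n) (s n \<omega>))
           (\<lambda>n. real (p n * n)) I_sym
       \<and> good_rate_function sym_weak_topology I_sym
       \<and> (\<forall>\<mu>. is_arg_min I_sym (\<lambda>\<nu>. \<nu> \<in> sym_prob_measures) \<mu> \<longleftrightarrow> \<mu> = rademacher)"
proof -
  interpret sv_sample p \<Omega> s
    by (intro sv_sample.intro sv_regime.intro sv_sample_axioms.intro) (fact assms)+
  show ?thesis
    using satisfies_LDP_I_sym good_rate_function_I_sym is_arg_min_I_sym_iff by blast
qed

end
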